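(* Let $A$ be a Banach $*$-algebra possessing a bounded one-sided approximate unit. Then every positive linear functional $\varphi$ on $A$ has finite variation, i.e. there exists $\gamma\ge0$ with $|\varphi(a)|^2\le\gamma\,\varphi(a^*a)$ for all $a\in A$, and $\varphi$ is continuous.
   Context: A Banach $*$-algebra is a complete complex algebra with an involution $a\mapsto a^*$ (conjugate linear, $(ab)^*=b^*a^*$, $a^{**}=a$) and a norm with $|ab|\le|a||b|$; the involution need not be continuous. A linear functional $\varphi$ is positive if $\varphi(a^*a)\ge0$ for all $a$. A bounded left (resp. right) approximate unit is a norm-bounded net $(e_i)_{i\in I}$ in $A$ with $e_ia\to a$ (resp. $ae_i\to a$) for all $a\in A$; a bounded one-sided approximate unit is a bounded left or a bounded right approximate unit. *)

theory Defs
  imports "HOL-Analysis.Analysis"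
begin

text \<open>A Banach *-algebra: the carrier type is a real Banach algebra (not necessarily
unital, norm submultiplicative, complete); the complex scalar multiplication
cscale extends the real one, and invol is an involution (no continuity assumed).\<close>

locale banach_star_algebra =
  fixes cscale :: "complex \<Rightarrow> 'a::{real_normed_algebra, banach} \<Rightarrow> 'a"
    and invol :: "'a \<Rightarrow> 'a"
  assumes cscale_of_real: "\<And>r x. cscale (complex_of_real r) x = scaleR r x"
    and cscale_add_left: "\<And>c d x. cscale (c + d) x = cscale c x + cscale d x"
    and cscale_add_right: "\<And>c x y. cscale c (x + y) = cscale c x + cscale c y"
    and cscale_assoc: "\<And>c d x. cscale c (cscale d x) = cscale (c * d) x"
    and cscale_one: "\<And>x. cscale 1 x = x"
    and cscale_mult_left: "\<And>c x y. cscale c (x * y) = cscale c x * y"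
    and cscale_mult_right: "\<And>c x y. cscale c (x * y) = x * cscale c y"
    and norm_cscale: "\<And>c x. norm (cscale c x) = cmod c * norm x"
    and invol_add: "\<And>x y. invol (x + y) = invol x + invol y"
    and invol_cscale: "\<And>c x. invol (cscale c x) = cscale (cnj c) (invol x)"
    and invol_mult: "\<And>x y. invol (x * y) = invol y * invol x"
    and invol_invol: "\<And>x. invol (invol x) = x"

definition directed_set :: "'i set \<Rightarrow> ('i \<Rightarrow> 'i \<Rightarrow> bool) \<Rightarrow> bool" where
  "directed_set I le \<longleftrightarrow> I \<noteq> {} \<and> (\<forall>i\<in>I. le i i) \<and>
     (\<forall>i\<in>I. \<forall>j\<in>I. \<forall>k\<in>I. le i j \<longrightarrow> le j k \<longrightarrow> le i k) \<and>
     (\<forall>i\<in>I. \<forall>j\<in>I. \<exists>k\<in>I. le i k \<and> le j k)"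

definition net_converges :: "'i set \<Rightarrow> ('i \<Rightarrow> 'i \<Rightarrow> bool) \<Rightarrow> ('i \<Rightarrow> 'a::metric_space) \<Rightarrow> 'a \<Rightarrow> bool" where
  "net_converges I le x l \<longleftrightarrow>
     (\<forall>\<epsilon>>0. \<exists>i0\<in>I. \<forall>i\<in>I. le i0 i \<longrightarrow> dist (x i) l < \<epsilon>)"

definition bounded_left_approx_unit ::
    "'i set \<Rightarrow> ('i \<Rightarrow> 'i \<Rightarrow> bool) \<Rightarrow> ('i \<Rightarrow> 'a::real_normed_algebra) \<Rightarrow> bool" where
  "bounded_left_approx_unit I le e \<longleftrightarrow> directed_set I le \<and>
     (\<exists>M. \<forall>i\<in>I. norm (e i) \<le> M) \<and> (\<forall>a. net_converges I le (\<lambda>i. e i * a) a)"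

definition bounded_right_approx_unit ::
    "'i set \<Rightarrow> ('i \<Rightarrow> 'i \<Rightarrow> bool) \<Rightarrow> ('i \<Rightarrow> 'a::real_normed_algebra) \<Rightarrow> bool" where
  "bounded_right_approx_unit I le e \<longleftrightarrow> directed_set I le \<and>
     (\<exists>M. \<forall>i\<in>I. norm (e i) \<le> M) \<and> (\<forall>a. net_converges I le (\<lambda>i. a * e i) a)"

definition complex_linear_functional ::
    "(complex \<Rightarrow> 'a \<Rightarrow> 'a) \<Rightarrow> ('a::plus \<Rightarrow> complex) \<Rightarrow> bool" where
  "complex_linear_functional cscale \<phi> \<longleftrightarrow>
     (\<forall>x y. \<phi> (x + y) = \<phi> x + \<phi> y) \<and> (\<forall>c x. \<phi> (cscale c x) = c * \<phi> x)"

definition positive_functional ::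
    "('a \<Rightarrow> 'a) \<Rightarrow> ('a::times \<Rightarrow> complex) \<Rightarrow> bool" where
  "positive_functional invol \<phi> \<longleftrightarrow>
     (\<forall>a. \<phi> (invol a * a) \<in> \<real> \<and> Re (\<phi> (invol a * a)) \<ge> 0)"

end

theory Submission
  imports Defs
begin

text \<open>Write \<open>p a = Re (\<phi> (star a \<odot> a))\<close>. Ford's square root lemma gives
  \<open>p (x \<odot> b) \<le> norm (star x) * norm x * p b\<close>, and a Baire argument replaces \<open>norm (star x)\<close> by
  a multiple of \<open>norm x\<close> although the involution may be discontinuous. With right units, Cohen
  factorization of null sequences, \<open>a n = c n \<odot> b\<close>, then forces \<open>p a \<le> K * (norm a)\<^sup>2\<close>. So the
  units \<open>e\<close> have bounded \<open>p e\<close>, and \<open>\<phi> (c \<odot> d)\<close> is a limit of the values \<open>\<phi> (star e \<odot> (c \<odot> d))\<close>, to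
  which the Cauchy--Schwarz inequality applies. Left units are right units of the opposite algebra,
  on which \<open>\<phi>\<close> is positive too.\<close>

text \<open>Two obstacles shape the proof: there is no unit, and \<open>star\<close> need not
  respect limits. Many formulas below are traces of identities in the unitization, which is never
  formed; a quasi-inverse of \<open>x\<close> stands for (1 - x)^-1 - 1. A contraction started from
  a hermitian \<open>h\<close> may converge to a non-hermitian root, which is why a spectral
  argument with Liouville's theorem enters. Likewise a small norm of \<open>z\<close> says nothing
  about the norm of \<open>star z\<close>, so the final estimates go through \<open>p\<close>, which
  sees only \<open>z\<close>. The product is a locale parameter rather than the class operation
  because the left and right cases need two products on one type. Continuity comes last: the square
  of |\<phi> x| is at most \<gamma> times \<open>p x\<close>, and \<open>p x\<close> is at most a
  constant times the square of the norm.\<close>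

section \<open>Quasi-inverses and quasi-square roots by contraction\<close>

locale banach_mult = bounded_bilinear mul
  for mul :: "'a::banach \<Rightarrow> 'a \<Rightarrow> 'a" (infixl "\<odot>" 70) +
  assumes assoc: "(x \<odot> y) \<odot> z = x \<odot> (y \<odot> z)"
    and norm_mul_le: "norm (x \<odot> y) \<le> norm x * norm y"
begin

lemmas mul_simps = add_left add_right diff_left diff_right minus_left minus_right
  scaleR_left scaleR_right zero_left zero_right assoc

text \<open>In the unitization \<open>1 + q\<close> is the inverse of \<open>1 - x\<close>. The
  element is the fixed point of the contraction sending \<open>q\<close> to
  \<open>x + x \<odot> q\<close>; the commutation rule, applied to \<open>x\<close> itself, turns
  the right inverse into a left one.\<close>

lemma quasi_inverse:
  assumes "norm x < 1"
  obtains q where "q = x + x \<odot> q" "q = x + q \<odot> x" "\<And>z. z \<odot> x = x \<odot> z \<Longrightarrow> z \<odot> q = q \<odot> z"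
    "norm q \<le> norm x + norm x * norm q"
proof -
  have zero: "d = 0" if "d = x \<odot> d" for d
  proof (rule ccontr)
    assume "d \<noteq> 0"
    have "norm d \<le> norm x * norm d" using norm_mul_le[of x d] that by simp
    with \<open>d \<noteq> 0\<close> assms show False by simp
  qed
  have "\<exists>!q. x + x \<odot> q = q"
  proof (rule banach_fix_type[of "norm x"])
    show "\<forall>p q. dist (x + x \<odot> p) (x + x \<odot> q) \<le> norm x * dist p q"
      by (simp add: dist_norm diff_right[symmetric] norm_mul_le)
  qed (use assms in auto)
  then obtain q where q: "q = x + x \<odot> q" by metis
  have comm: "z \<odot> q = q \<odot> z" if z: "z \<odot> x = x \<odot> z" for z
  proof -
    have "z \<odot> q = z \<odot> x + (z \<odot> x) \<odot> q" by (subst q) (simp add: mul_simps)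
    also have "\<dots> = x \<odot> z + x \<odot> (z \<odot> q)" by (simp add: z assoc)
    finally have 1: "z \<odot> q = x \<odot> z + x \<odot> (z \<odot> q)" .
    have 2: "q \<odot> z = x \<odot> z + x \<odot> (q \<odot> z)" by (subst q) (simp add: mul_simps)
    have "z \<odot> q - q \<odot> z = x \<odot> (z \<odot> q - q \<odot> z)"
      by (subst 1, subst 2) (simp add: mul_simps)
    from zero[OF this] show ?thesis by simp
  qed
  show thesis
  proof (rule that[OF q _ comm])
    show "q = x + q \<odot> x" using q comm[of x] by simp
    have "norm q \<le> norm x + norm (x \<odot> q)" by (subst q) (rule norm_triangle_ineq)
    then show "norm q \<le> norm x + norm x * norm q" using norm_mul_le[of x q] by linarith
  qed
qed

text \<open>The equation for \<open>y\<close> says that 1 - h is the square of 1 - y in the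
  unitization. Rewritten as y = (h + y y) / 2, it is a fixed point problem on a small ball.\<close>

lemma quasi_square_root:
  assumes "norm h < 1"
  obtains y where "norm y < 1" "2 *\<^sub>R y - y \<odot> y = h" "\<And>z. z \<odot> h = h \<odot> z \<Longrightarrow> z \<odot> y = y \<odot> z"
proof -
  \<comment> \<open>The smaller root of 2 t = norm h + t^2: the ball of this radius is mapped into
    itself, and \<rho> < 1 is also the contraction factor there.\<close>
  define \<rho> where "\<rho> = 1 - sqrt (1 - norm h)"
  have \<rho>: "0 \<le> \<rho>" "\<rho> < 1" using assms by (auto simp: \<rho>_def)
  have \<rho>2: "norm h + \<rho> * \<rho> = 2 * \<rho>"
  proof -
    have "sqrt (1 - norm h) * sqrt (1 - norm h) = 1 - norm h" using assms by simp
    then show ?thesis by (simp add: \<rho>_def algebra_simps)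
  qed
  let ?f = "\<lambda>y. (1/2) *\<^sub>R (h + y \<odot> y)"
  have "\<exists>!y\<in>cball 0 \<rho>. ?f y = y"
  proof (rule Banach_fix[of _ \<rho>])
    show "complete (cball (0::'a) \<rho>)" by (simp add: complete_eq_closed)
    show "?f ` cball 0 \<rho> \<subseteq> cball 0 \<rho>"
    proof clarsimp
      fix y :: 'a assume "norm y \<le> \<rho>"
      then have "norm (y \<odot> y) \<le> \<rho> * \<rho>"
        using norm_mul_le[of y y] mult_mono[of "norm y" \<rho> "norm y" \<rho>] \<rho> by simp
      then show "norm (h + y \<odot> y) \<le> \<rho> * 2"
        using norm_triangle_ineq[of h "y \<odot> y"] \<rho>2 by linarith
    qed
    show "dist (?f x) (?f y) \<le> \<rho> * dist x y" if "x \<in> cball 0 \<rho>" "y \<in> cball 0 \<rho>" for x y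
    proof -
      have "norm (x \<odot> (x - y)) \<le> \<rho> * norm (x - y)" "norm ((x - y) \<odot> y) \<le> norm (x - y) * \<rho>"
        using that norm_mul_le[of x "x - y"] norm_mul_le[of "x - y" y]
          mult_right_mono[of "norm x" \<rho> "norm (x - y)"] mult_left_mono[of "norm y" \<rho> "norm (x - y)"]
        by auto
      moreover
      have "?f x - ?f y = (1/2) *\<^sub>R (x \<odot> (x - y) + (x - y) \<odot> y)"
        by (simp add: mul_simps algebra_simps)
      then have "dist (?f x) (?f y) = norm (x \<odot> (x - y) + (x - y) \<odot> y) / 2"
        unfolding dist_norm by simp
      ultimately show ?thesis
        using norm_triangle_ineq[of "x \<odot> (x - y)" "(x - y) \<odot> y"]
        by (simp only: dist_norm mult.commute[of \<rho>])
    qed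
  qed (use \<rho> in auto)
  then obtain y where y: "norm y \<le> \<rho>" "?f y = y" by auto
  have y2: "2 *\<^sub>R y = h + y \<odot> y" by (subst y(2)[symmetric]) simp
  show thesis
  proof (rule that)
    show "norm y < 1" using y \<rho> by simp
    show "2 *\<^sub>R y - y \<odot> y = h" by (simp add: y2)
    fix z assume z: "z \<odot> h = h \<odot> z"
    \<comment> \<open>The commutator satisfies 2 d = d y + y d, which forces d = 0 because
      \<open>norm y < 1\<close>.\<close>
    define d where "d = z \<odot> y - y \<odot> z"
    have "2 *\<^sub>R d = z \<odot> (2 *\<^sub>R y) - (2 *\<^sub>R y) \<odot> z" by (simp add: d_def mul_simps algebra_simps)
    also have "\<dots> = z \<odot> (y \<odot> y) - (y \<odot> y) \<odot> z" unfolding y2 by (simp add: mul_simps z)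
    also have "\<dots> = d \<odot> y + y \<odot> d" by (simp add: d_def mul_simps)
    finally have "2 * norm d = norm (d \<odot> y + y \<odot> d)"
      by (metis norm_scaleR abs_numeral)
    also have "\<dots> \<le> norm d * norm y + norm y * norm d"
      by (intro order_trans[OF norm_triangle_ineq] add_mono norm_mul_le)
    finally have "norm d * (1 - norm y) \<le> 0" by (simp add: algebra_simps)
    then have "norm d = 0" using y \<rho> by (simp add: mult_le_0_iff)
    then show "z \<odot> y = y \<odot> z" by (simp add: d_def)
  qed
qed

end

section \<open>Liouville's theorem for vector-valued functions, and resolvents\<close>

locale complex_banach =
  fixes cscale :: "complex \<Rightarrow> 'a::banach \<Rightarrow> 'a"
  assumes cscale_of_real: "cscale (complex_of_real r) x = scaleR r x"
    and cscale_add_left: "cscale (c + d) x = cscale c x + cscale d x"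
    and cscale_add_right: "cscale c (x + y) = cscale c x + cscale c y"
    and cscale_assoc: "cscale c (cscale d x) = cscale (c * d) x"
    and norm_cscale: "norm (cscale c x) = cmod c * norm x"
begin

sublocale cs: bounded_bilinear cscale
proof
  show "cscale (r *\<^sub>R c) x = r *\<^sub>R cscale c x" for r c x
    by (simp add: cscale_of_real[symmetric] cscale_assoc scaleR_conv_of_real)
  show "cscale c (r *\<^sub>R x) = r *\<^sub>R cscale c x" for r c x
    by (simp add: cscale_of_real[symmetric] cscale_assoc mult.commute)
  show "\<exists>K. \<forall>c x. norm (cscale c x) \<le> norm c * norm x * K"
    by (rule exI[of _ 1]) (simp add: norm_cscale)
qed (simp_all add: cscale_add_left cscale_add_right)

lemma cscale_one [simp]: "cscale 1 x = x"
  using cscale_of_real[of 1 x] by simp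

lemmas cs_simps = cs.add_left cs.add_right cs.diff_left cs.diff_right cs.minus_left cs.minus_right
  cs.scaleR_left cs.scaleR_right cs.zero_left cs.zero_right cscale_assoc

text \<open>The integral of \<open>g\<close> over the circle of radius \<open>exp s\<close>, with respect to the angle, does not
  depend on \<open>s\<close>; it tends to \<open>0\<close> as \<open>s\<close> grows and to \<open>2 * pi\<close> times \<open>g 0\<close> as \<open>s\<close> decreases.\<close>

lemma liouville_at_infinity:
  assumes deriv: "\<And>z. (g has_derivative (\<lambda>d. cscale d (g' z))) (at z)"
    and cont: "continuous_on UNIV g'"
    and lim: "(g \<longlongrightarrow> 0) at_infinity"
  shows "g 0 = 0"
proof -
  have contg: "continuous_on UNIV g"
    using deriv by (meson continuous_at_imp_continuous_on has_derivative_continuous)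
  \<comment> \<open>This is the derivative of \<open>g (exp (Complex s t))\<close> in
    \<open>s\<close>; the derivative in \<open>t\<close> is \<open>\<i>\<close> times it. This
    relation is the Cauchy-Riemann equation in polar form.\<close>
  define k where "k s t = cscale (exp (Complex s t)) (g' (exp (Complex s t)))" for s t
  define J where "J s = integral {0..2*pi} (\<lambda>t. g (exp (Complex s t)))" for s
  have Cdef: "Complex s t = of_real s + \<i> * of_real t" for s t by (simp add: complex_eq_iff)
  have ds: "((\<lambda>s. g (exp (Complex s t))) has_vector_derivative k s t) (at s within S)" for s t S
  proof -
    have "((\<lambda>s. exp (Complex s t)) has_derivative (\<lambda>h. of_real h * exp (Complex s t))) (at s within S)"
      by (rule has_derivative_eq_rhs[OF has_derivative_compose[where g=exp and g'="(*) (exp (Complex s t))"]])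
        (auto intro!: derivative_eq_intros DERIV_exp[unfolded has_field_derivative_def] simp: Cdef mult.commute)
    from has_derivative_compose[OF this deriv] show ?thesis
      unfolding has_vector_derivative_def k_def
      by (simp add: cscale_assoc[symmetric] cscale_of_real)
  qed
  have dt: "((\<lambda>t. g (exp (Complex s t))) has_vector_derivative cscale \<i> (k s t)) (at t within S)" for s t S
  proof -
    have "((\<lambda>t. exp (Complex s t)) has_derivative (\<lambda>h. of_real h * (\<i> * exp (Complex s t)))) (at t within S)"
      by (rule has_derivative_eq_rhs[OF has_derivative_compose[where g=exp and g'="(*) (exp (Complex s t))"]])
        (auto intro!: derivative_eq_intros DERIV_exp[unfolded has_field_derivative_def] simp: Cdef mult_ac)
    from has_derivative_compose[OF this deriv] show ?thesis
      unfolding has_vector_derivative_def k_def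
      by (simp add: cscale_assoc[symmetric] cscale_of_real)
  qed
  have intg: "(\<lambda>t. g (exp (Complex s t))) integrable_on {0..2*pi}" for s
    unfolding Cdef
    by (intro integrable_continuous_interval continuous_intros
        continuous_on_compose2[OF contg]) auto
  \<comment> \<open>Up to the factor \<open>\<i>\<close> the integrand is a derivative in
    \<open>t\<close>, and its primitive has period 2 pi.\<close>
  have k0: "integral {0..2*pi} (k s) = 0" for s
  proof -
    have "((\<lambda>t. cscale \<i> (k s t)) has_integral (g (exp (Complex s (2*pi))) - g (exp (Complex s 0)))) {0..2*pi}"
      by (intro fundamental_theorem_of_calculus dt) auto
    moreover have "exp (Complex s (2*pi)) = exp (Complex s 0)"
      by (simp add: exp_eq_polar complex_eq_iff Complex_eq exp_add)
    ultimately have "((\<lambda>t. cscale \<i> (k s t)) has_integral 0) {0..2*pi}" by simp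
    from has_integral_linear[OF this cs.bounded_linear_right[of "- \<i>"]]
    have "(k s has_integral 0) {0..2*pi}" by (simp add: o_def cscale_assoc cs.zero_right)
    then show ?thesis by (rule integral_unique)
  qed
  have "(J has_vector_derivative 0) (at s)" for s
  proof -
    have "((\<lambda>s. integral (cbox 0 (2*pi)) (\<lambda>t. g (exp (Complex s t)))) has_vector_derivative
        integral (cbox 0 (2*pi)) (k s)) (at s within UNIV)"
    proof (rule leibniz_rule_vector_derivative)
      show "continuous_on (UNIV \<times> cbox 0 (2*pi)) (\<lambda>(s, t). k s t)"
        unfolding k_def split_beta Cdef
        by (intro cs.continuous_on continuous_intros continuous_on_compose2[OF cont]) auto
    qed (use ds intg in auto)
    then show ?thesis by (simp add: J_def[abs_def] k0)
  qed
  then have Jconst: "J s = J s'" for s s'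
    by (intro has_derivative_zero_unique[of UNIV J]) (auto simp: has_vector_derivative_def)
  have Jbound: "norm (J s) \<le> \<epsilon> * (2*pi)"
    if "\<And>t. norm (g (exp (Complex s t))) \<le> \<epsilon>" for s \<epsilon>
    unfolding J_def using that
    by (intro order_trans[OF integral_bound[where B=\<epsilon>]])
      (auto simp: Cdef intro!: continuous_intros continuous_on_compose2[OF contg])
  have J0: "J s = 0" for s
  proof -
    have "norm (J s) \<le> \<epsilon> * (2*pi)" if "\<epsilon> > 0" for \<epsilon>
    proof -
      from lim that have "\<forall>\<^sub>F z in at_infinity. norm (g z) < \<epsilon>"
        by (simp add: tendsto_iff)
      then obtain b where b: "\<And>z. b \<le> norm z \<Longrightarrow> norm (g z) < \<epsilon>"
        by (auto simp: eventually_at_infinity)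
      have "norm (g (exp (Complex (ln (max 1 b)) t))) \<le> \<epsilon>" for t
        by (rule less_imp_le, rule b) (simp add: exp_ln)
      from Jbound[OF this] show ?thesis using Jconst by metis
    qed
    then have "norm (J s) \<le> \<epsilon>" if "\<epsilon> > 0" for \<epsilon>
      using that by (metis divide_pos_pos nonzero_eq_divide_eq pi_gt_zero mult_pos_pos zero_less_numeral less_numeral_extra(3))
    then have "norm (J s) \<le> 0" by (rule field_le_epsilon[where y=0, simplified])
    then show ?thesis by simp
  qed
  have "2 * pi * norm (g 0) \<le> \<epsilon> * (2*pi)" if "\<epsilon> > 0" for \<epsilon>
  proof -
    from contg that obtain \<delta> where \<delta>: "\<delta> > 0" "\<And>z. norm z < \<delta> \<Longrightarrow> norm (g z - g 0) < \<epsilon>"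
      unfolding continuous_on_iff dist_norm by (metis UNIV_I diff_zero)
    have le: "norm (g (exp (Complex (ln (\<delta>/2)) t)) - g 0) \<le> \<epsilon>" for t
      by (rule less_imp_le, rule \<delta>) (use \<delta>(1) in \<open>simp\<close>)
    have "integral {0..2*pi} (\<lambda>t. g (exp (Complex (ln (\<delta>/2)) t)) - g 0) = - ((2*pi) *\<^sub>R g 0)"
      using J0[of "ln (\<delta>/2)"] intg unfolding J_def by (subst integral_diff) auto
    moreover have "norm (integral {0..2*pi} (\<lambda>t. g (exp (Complex (ln (\<delta>/2)) t)) - g 0)) \<le> \<epsilon> * (2*pi - 0)"
      using le
      by (intro integral_bound) (auto simp: Cdef intro!: continuous_intros continuous_on_compose2[OF contg])
    ultimately show ?thesis by simp
  qed
  then have "norm (g 0) \<le> \<epsilon>" if "\<epsilon> > 0" for \<epsilon> using that by (simp add: mult.commute)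
  then have "norm (g 0) \<le> 0" by (rule field_le_epsilon[where y=0, simplified])
  then show ?thesis by simp
qed

text \<open>This is the nonemptiness of the spectrum: on \<open>V\<close> the operator
  \<open>Y\<close> has a resolvent \<open>R z\<close> at every complex number, so
  \<open>R z a\<close> is entire and, as \<open>Y\<close> is bounded, vanishes at infinity. Hence
  \<open>R 0 a = 0\<close>, and inverting at 0 kills \<open>a\<close>.\<close>

lemma everywhere_resolvent_imp_trivial:
  fixes Y :: "'a \<Rightarrow> 'a" and R :: "complex \<Rightarrow> 'a \<Rightarrow> 'a"
  assumes lin: "\<And>z. bounded_linear (R z)"
    and R_cscale: "\<And>z c a. R z (cscale c a) = cscale c (R z a)"
    and R_in: "\<And>z a. a \<in> V \<Longrightarrow> R z a \<in> V"
    and right_inv: "\<And>z a. a \<in> V \<Longrightarrow> cscale z (R z a) - Y (R z a) = a"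
    and left_inv: "\<And>z a. a \<in> V \<Longrightarrow> R z (cscale z a - Y a) = a"
    and Y: "\<And>a. norm (Y a) \<le> K * norm a"
    and a: "a \<in> V"
  shows "a = 0"
proof -
  have resolvent: "R w b - R z b = cscale (z - w) (R z (R w b))" if "b \<in> V" for z w b
  proof -
    interpret Rz: bounded_linear "R z" by (rule lin)
    let ?x = "R w b"
    have "?x = R z (cscale z ?x - Y ?x)" using left_inv R_in that by simp
    also have "cscale z ?x - Y ?x = cscale (z - w) ?x + b"
      using right_inv[OF that, of w] by (simp add: cs_simps algebra_simps)
    also have "R z \<dots> = cscale (z - w) (R z ?x) + R z b"
      by (simp add: Rz.add R_cscale)
    finally show ?thesis by (simp add: algebra_simps)
  qed
  have local: "\<exists>D>0. \<exists>\<delta>>0. \<forall>w. norm (w - z) < \<delta> \<longrightarrow>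
      norm (R w a - R z a - cscale (w - z) (- R z (R z a))) \<le> D * norm (w - z) * norm (w - z) \<and>
      norm (- R w (R w a) - - R z (R z a)) \<le> D * norm (w - z)" for z
  proof -
    obtain C where C: "C > 0" "\<And>b. norm (R z b) \<le> norm b * C"
      using bounded_linear.pos_bounded[OF lin] by blast
    interpret Rz: bounded_linear "R z" by (rule lin)
    \<comment> \<open>For \<open>w\<close> this close to \<open>z\<close>, the resolvent identity
      bounds the change of \<open>R w b\<close> by half of \<open>norm (R w b)\<close>. Absorbing
      that half gives \<open>bd\<close>; inserting \<open>bd\<close> back gives
      \<open>lip\<close>.\<close>
    have lip: "norm (R w b - R z b) \<le> norm (w - z) * (2 * C * C) * norm b" and
      bd: "norm (R w b) \<le> 2 * C * norm b"
      if w: "norm (w - z) < 1 / (2 * C)" and b: "b \<in> V" for w b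
    proof -
      have eq: "norm (R w b - R z b) = norm (w - z) * norm (R z (R w b))"
        using resolvent[OF b, of w z] by (simp add: norm_cscale norm_minus_commute)
      also have "\<dots> \<le> norm (w - z) * (norm (R w b) * C)"
        by (intro mult_left_mono C) auto
      finally have 1: "norm (R w b - R z b) \<le> norm (w - z) * (norm (R w b) * C)" .
      have "norm (w - z) * (norm (R w b) * C) \<le> 1 / (2 * C) * (norm (R w b) * C)"
        using w C by (intro mult_right_mono) auto
      also have "\<dots> = norm (R w b) / 2" using C by simp
      finally have "norm (R w b) \<le> norm (R z b) + norm (R w b) / 2"
        using 1 norm_triangle_sub[of "R w b" "R z b"] by linarith
      moreover have "2 * (norm b * C) = 2 * C * norm b" by simp
      ultimately show 2: "norm (R w b) \<le> 2 * C * norm b" using C(2)[of b] by linarith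
      have "norm (w - z) * (norm (R w b) * C) \<le> norm (w - z) * (2 * C * norm b * C)"
        using 2 C(1) by (intro mult_left_mono mult_right_mono) auto
      with 1 show "norm (R w b - R z b) \<le> norm (w - z) * (2 * C * C) * norm b"
        by (simp add: algebra_simps)
    qed
    \<comment> \<open>In \<open>R w (R w a) - R z (R z a)\<close> changing the outer resolvent
      contributes 4 and the inner one 2. Adding 1 to \<open>norm a\<close> keeps \<open>D\<close>
      positive.\<close>
    define D where "D = 6 * C * C * C * (norm a + 1)"
    have D: "D > 0" using C by (auto simp: D_def intro!: mult_pos_pos add_nonneg_pos)
    show ?thesis
    proof (rule exI[of _ D], intro conjI D, rule exI[of _ "1 / (2 * C)"], intro conjI allI impI)
      fix w assume w: "norm (w - z) < 1 / (2 * C)"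
      have c3: "C * C * C * norm a * norm (w - z) \<le> C * C * C * (norm a + 1) * norm (w - z)"
        using C by (intro mult_right_mono mult_left_mono) auto
      have "R z (R w a - R z a) = R z (R w a) - R z (R z a)" by (simp add: Rz.diff)
      then have z1: "norm (R z (R w a) - R z (R z a)) \<le> norm (w - z) * (2 * C * C) * norm a * C"
        using order_trans[OF C(2)[of "R w a - R z a"] mult_right_mono[OF lip[OF w a], of C]] C(1)
        by simp
      have "R w a - R z a - cscale (w - z) (- R z (R z a)) =
          cscale (z - w) (R z (R w a) - R z (R z a))"
        by (subst resolvent[OF a]) (simp add: cs_simps algebra_simps)
      then have "norm (R w a - R z a - cscale (w - z) (- R z (R z a))) =
          norm (w - z) * norm (R z (R w a) - R z (R z a))"
        by (simp add: norm_cscale norm_minus_commute)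
      also have "\<dots> \<le> norm (w - z) * (D * norm (w - z))"
      proof (rule mult_left_mono)
        have "norm (w - z) * (2 * C * C) * norm a * C \<le> D * norm (w - z)"
          using c3 C by (simp add: D_def algebra_simps)
        with z1 show "norm (R z (R w a) - R z (R z a)) \<le> D * norm (w - z)" by simp
      qed simp
      finally show "norm (R w a - R z a - cscale (w - z) (- R z (R z a)))
          \<le> D * norm (w - z) * norm (w - z)" by (simp add: algebra_simps)
      have "norm (R w (R w a) - R z (R w a)) \<le> norm (w - z) * (2 * C * C) * norm (R w a)"
        by (rule lip[OF w R_in[OF a]])
      also have "\<dots> \<le> norm (w - z) * (2 * C * C) * (2 * C * norm a)"
        using bd[OF w a] C(1) by (intro mult_left_mono) auto
      finally have "norm (R w (R w a) - R z (R w a)) \<le> norm (w - z) * (2 * C * C) * (2 * C * norm a)" .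
      with z1 have "norm (R w (R w a) - R z (R z a)) \<le>
          norm (w - z) * (2 * C * C) * (2 * C * norm a) + norm (w - z) * (2 * C * C) * norm a * C"
        using norm_triangle_ineq[of "R w (R w a) - R z (R w a)" "R z (R w a) - R z (R z a)"]
        by (simp only: diff_add_cancel add_diff_eq)
      also have "\<dots> = 6 * (C * C * C * norm a * norm (w - z))" by (simp add: algebra_simps)
      also have "\<dots> \<le> D * norm (w - z)" using c3 by (simp add: D_def algebra_simps)
      finally show "norm (- R w (R w a) - - R z (R z a)) \<le> D * norm (w - z)"
        by (simp add: norm_minus_commute)
    qed (use D C in auto)
  qed
  have "R 0 a = 0"
  proof (rule liouville_at_infinity[of "\<lambda>z. R z a" "\<lambda>z. - R z (R z a)"])
    fix z
    obtain D \<delta> where D: "D > 0" "\<delta> > 0" "\<And>w. norm (w - z) < \<delta> \<Longrightarrow>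
      norm (R w a - R z a - cscale (w - z) (- R z (R z a))) \<le> D * norm (w - z) * norm (w - z)"
      using local[of z] by blast
    show "((\<lambda>z. R z a) has_derivative (\<lambda>d. cscale d (- R z (R z a)))) (at z)"
    proof (rule has_derivativeI_sandwich[OF D(2) cs.bounded_linear_left])
      fix w assume "w \<noteq> z" "dist w z < \<delta>"
      with D(3)[of w] show "norm (R w a - R z a - cscale (w - z) (- R z (R z a))) / norm (w - z)
          \<le> D * norm (w - z)"
        by (simp add: dist_norm divide_le_eq)
    next
      show "((\<lambda>w. D * norm (w - z)) \<longlongrightarrow> 0) (at z)" by (auto intro!: tendsto_eq_intros)
    qed
  next
    show "continuous_on UNIV (\<lambda>z. - R z (R z a))"
    proof (intro continuous_at_imp_continuous_on ballI)
      fix z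
      obtain D \<delta> where D: "D > 0" "\<delta> > 0" "\<And>w. norm (w - z) < \<delta> \<Longrightarrow>
        norm (- R w (R w a) - - R z (R z a)) \<le> D * norm (w - z)"
        using local[of z] by blast
      have "((\<lambda>w. - R w (R w a) - - R z (R z a)) \<longlongrightarrow> 0) (at z)"
      proof (rule Lim_null_comparison)
        show "\<forall>\<^sub>F w in at z. norm (- R w (R w a) - - R z (R z a)) \<le> D * norm (w - z)"
          using D(2,3) by (auto simp: eventually_at dist_norm)
        show "((\<lambda>w. D * norm (w - z)) \<longlongrightarrow> 0) (at z)" by (auto intro!: tendsto_eq_intros)
      qed
      then show "isCont (\<lambda>z. - R z (R z a)) z" unfolding isCont_def by (rule LIM_zero_cancel)
    qed
  next
    have "norm (R z a) \<le> norm a / (norm z - K)" if "norm z > K" for z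
    proof -
      have "norm (cscale z (R z a)) \<le> norm a + K * norm (R z a)"
        using right_inv[OF a, of z] Y[of "R z a"] norm_triangle_ineq[of "a" "Y (R z a)"]
        by (simp add: algebra_simps)
      with that show ?thesis by (simp add: norm_cscale pos_le_divide_eq algebra_simps)
    qed
    then have "\<forall>\<^sub>F z in at_infinity. norm (R z a) \<le> norm a / (norm z - K)"
      by (auto simp: eventually_at_infinity intro!: exI[of _ "K + 1"])
    moreover have "((\<lambda>z::complex. norm a / (norm z - K)) \<longlongrightarrow> 0) at_infinity"
    proof -
      have "filterlim (\<lambda>z::complex. - K + norm z) at_top at_infinity"
        by (intro filterlim_tendsto_add_at_top[OF tendsto_const] filterlim_norm_at_top)
      then have "filterlim (\<lambda>z::complex. norm z - K) at_infinity at_infinity"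
        by (intro filterlim_at_top_imp_at_infinity) (simp add: algebra_simps)
      then show ?thesis by (intro tendsto_divide_0[OF tendsto_const])
    qed
    ultimately show "((\<lambda>z. R z a) \<longlongrightarrow> 0) at_infinity" by (rule Lim_null_comparison)
  qed
  with right_inv[OF a, of 0] Y[of 0] show ?thesis by (simp add: cs_simps)
qed

end

section \<open>Ford's square root lemma\<close>

locale banach_star = banach_mult mul + complex_banach cscale
  for mul :: "'a::banach \<Rightarrow> 'a \<Rightarrow> 'a" (infixl "\<odot>" 70)
    and cscale :: "complex \<Rightarrow> 'a \<Rightarrow> 'a" +
  fixes star :: "'a \<Rightarrow> 'a"
  assumes cscale_mul_left: "cscale c (x \<odot> y) = cscale c x \<odot> y"
    and cscale_mul_right: "cscale c (x \<odot> y) = x \<odot> cscale c y"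
    and star_add: "star (x + y) = star x + star y"
    and star_cscale: "star (cscale c x) = cscale (cnj c) (star x)"
    and star_mul: "star (x \<odot> y) = star y \<odot> star x"
    and star_star [simp]: "star (star x) = x"
begin

sublocale star: linear star
proof
  show "star (r *\<^sub>R x) = r *\<^sub>R star x" for r x
    by (simp add: cscale_of_real[symmetric] star_cscale)
qed (rule star_add)

text \<open>Ford's square root lemma. If the root \<open>y\<close> obtained by contraction were not hermitian, then
  \<open>y + star y\<close> would act as \<open>2\<close> on \<open>y - star y\<close>. There the resolvent of \<open>star y\<close> at \<open>2 - z\<close>
  provides a resolvent of \<open>y\<close> at \<open>z\<close> in the disc where that of \<open>y\<close> itself may fail to exist.\<close>

lemma hermitian_quasi_square_root:
  assumes h: "star h = h" "norm h < 1"
  obtains y where "star y = y" "2 *\<^sub>R y - y \<odot> y = h"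
proof -
  obtain y where y: "norm y < 1" "2 *\<^sub>R y - y \<odot> y = h"
    and comm: "\<And>z. z \<odot> h = h \<odot> z \<Longrightarrow> z \<odot> y = y \<odot> z"
    using quasi_square_root[OF h(2)] by metis
  have yy: "y \<odot> y = 2 *\<^sub>R y - h" using y(2) by (simp add: algebra_simps)
  have sy: "star y \<odot> star y = 2 *\<^sub>R star y - h"
    using arg_cong[OF yy, of star] by (simp add: star_mul star.diff star.scaleR h)
  have hy: "y \<odot> h = h \<odot> y"
    using y(2) by (auto simp: mul_simps)
  \<comment> \<open>As \<open>y\<close> commutes with everything that commutes with
    \<open>h\<close>, it is enough that \<open>star y\<close> commutes with the hermitian
    \<open>h\<close>.\<close>
  have "star y \<odot> h = h \<odot> star y"
    using arg_cong[OF hy, of star] by (simp add: star_mul h)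
  then have yc: "star y \<odot> y = y \<odot> star y" by (rule comm)
  have "\<exists>q. \<forall>w. 1 \<le> norm w \<longrightarrow> q w = cscale (1/w) y + cscale (1/w) y \<odot> q w
      \<and> q w = cscale (1/w) y + q w \<odot> cscale (1/w) y \<and> q w \<odot> y = y \<odot> q w
      \<and> q w \<odot> star y = star y \<odot> q w"
  proof (intro choice allI)
    fix w :: complex
    show "\<exists>q. 1 \<le> norm w \<longrightarrow> q = cscale (1/w) y + cscale (1/w) y \<odot> q
      \<and> q = cscale (1/w) y + q \<odot> cscale (1/w) y \<and> q \<odot> y = y \<odot> q \<and> q \<odot> star y = star y \<odot> q"
    proof (cases "1 \<le> norm w")
      case True
      have "norm (cscale (1/w) y) < 1"
        using y True by (simp add: norm_cscale norm_divide divide_less_eq)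
      then obtain q where q: "q = cscale (1/w) y + cscale (1/w) y \<odot> q"
        "q = cscale (1/w) y + q \<odot> cscale (1/w) y"
        "\<And>z. z \<odot> cscale (1/w) y = cscale (1/w) y \<odot> z \<Longrightarrow> z \<odot> q = q \<odot> z"
        using quasi_inverse by metis
      have "z \<odot> q = q \<odot> z" if "z \<odot> y = y \<odot> z" for z
        using that by (intro q(3)) (simp add: cscale_mul_left[symmetric] cscale_mul_right[symmetric])
      with q(1,2) yc show ?thesis by metis
    qed simp
  qed
  then obtain q where Q: "\<forall>w. 1 \<le> norm w \<longrightarrow> q w = cscale (1/w) y + cscale (1/w) y \<odot> q w
      \<and> q w = cscale (1/w) y + q w \<odot> cscale (1/w) y \<and> q w \<odot> y = y \<odot> q w
      \<and> q w \<odot> star y = star y \<odot> q w" ..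
  have q1: "q w = cscale (1/w) y + cscale (1/w) y \<odot> q w"
    and q2: "q w = cscale (1/w) y + q w \<odot> cscale (1/w) y"
    and qy: "q w \<odot> y = y \<odot> q w" and qsy: "q w \<odot> star y = star y \<odot> q w"
    if "1 \<le> norm w" for w
    using Q[rule_format, OF that] by blast+
  define r where "r w = star (q (cnj w))" for w
  have r1: "r w = cscale (1/w) (star y) + cscale (1/w) (star y) \<odot> r w"
    and r2: "r w = cscale (1/w) (star y) + r w \<odot> cscale (1/w) (star y)"
    and ry: "r w \<odot> star y = star y \<odot> r w" and rsy: "r w \<odot> y = y \<odot> r w"
    if "1 \<le> norm w" for w
  proof -
    have w: "1 \<le> norm (cnj w)" using that by simp
    note st = r_def star_add star_mul star_cscale
    have "r w = star (cscale (1 / cnj w) y + q (cnj w) \<odot> cscale (1 / cnj w) y)"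
      unfolding r_def by (rule arg_cong[OF q2[OF w]])
    then show "r w = cscale (1/w) (star y) + cscale (1/w) (star y) \<odot> r w"
      unfolding st by simp
    have "r w = star (cscale (1 / cnj w) y + cscale (1 / cnj w) y \<odot> q (cnj w))"
      unfolding r_def by (rule arg_cong[OF q1[OF w]])
    then show "r w = cscale (1/w) (star y) + r w \<odot> cscale (1/w) (star y)"
      unfolding st by simp
    show "r w \<odot> star y = star y \<odot> r w"
      using arg_cong[OF qy[OF w], of star] by (simp add: st)
    show "r w \<odot> y = y \<odot> r w"
      using arg_cong[OF qsy[OF w], of star] by (simp add: st)
  qed
  \<comment> \<open>Outside the open unit disc this is (z - y)^-1. Inside, z - y acts on
    \<open>V\<close> as -((2 - z) - star y), and 2 - z has modulus at least 1, so
    \<open>r (2-z)\<close> applies.\<close>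
  define R where "R z a = (if 1 \<le> norm z then cscale (1/z) (a + q z \<odot> a)
      else cscale (- 1/(2-z)) (a + r (2-z) \<odot> a))" for z a
  define V where "V = {a. (y + star y) \<odot> a = 2 *\<^sub>R a}"
  have V2: "cscale 2 a = 2 *\<^sub>R a" for a using cscale_of_real[of 2 a] by simp
  have Vy: "y \<odot> a = 2 *\<^sub>R a - star y \<odot> a" if "a \<in> V" for a
    using that by (simp add: V_def add_left eq_diff_eq)
  have norm2: "1 \<le> norm (2 - z)" "2 - z \<noteq> 0" if "\<not> 1 \<le> norm z" for z :: complex
    using that norm_triangle_ineq2[of 2 z] by auto
  \<comment> \<open>Here \<open>1 + p\<close> is a right inverse of \<open>1 - x\<close> in the
    unitization; in \<open>ivr\<close> it is a left inverse.\<close>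
  have ivl: "cscale c (a + p \<odot> a) - x \<odot> cscale c (a + p \<odot> a) = cscale c a"
    if "p = x + x \<odot> p" for c p x a
  proof -
    have "x \<odot> (a + p \<odot> a) = (x + x \<odot> p) \<odot> a" by (simp add: mul_simps)
    also have "\<dots> = p \<odot> a" using that by simp
    finally have "x \<odot> (a + p \<odot> a) = p \<odot> a" .
    then show ?thesis
      unfolding cscale_mul_right[symmetric] cs.diff_right[symmetric] by simp
  qed
  have ivr: "(a - x \<odot> a) + p \<odot> (a - x \<odot> a) = a" if "p = x + p \<odot> x" for p x a
  proof -
    have "x \<odot> a + p \<odot> (x \<odot> a) = (x + p \<odot> x) \<odot> a" by (simp add: mul_simps)
    also have "\<dots> = p \<odot> a" using that by simp
    finally show ?thesis by (simp add: mul_simps algebra_simps)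
  qed
  have "y - star y = 0"
  proof (rule everywhere_resolvent_imp_trivial[of R V "\<lambda>a. y \<odot> a" "norm y"])
    fix z
    show "bounded_linear (R z)"
      unfolding R_def
      by (cases "1 \<le> norm z")
        (auto intro!: bounded_linear_compose[OF cs.bounded_linear_right] bounded_linear_add
          bounded_linear_ident bounded_linear_right)
  next
    fix z c a
    show "R z (cscale c a) = cscale c (R z a)"
      by (simp add: R_def cscale_mul_right[symmetric] cscale_add_right[symmetric] cscale_assoc mult.commute)
  next
    fix z a assume a: "a \<in> V"
    have V_in: "cscale c (a + p \<odot> a) \<in> V" if "p \<odot> y = y \<odot> p" "p \<odot> star y = star y \<odot> p" for c p
    proof -
      have "(y + star y) \<odot> (p \<odot> a) = ((y + star y) \<odot> p) \<odot> a" by (simp add: assoc)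
      also have "\<dots> = (p \<odot> (y + star y)) \<odot> a" by (simp add: add_left add_right that)
      also have "\<dots> = p \<odot> ((y + star y) \<odot> a)" by (simp add: assoc)
      also have "\<dots> = 2 *\<^sub>R (p \<odot> a)" using a by (simp add: V_def scaleR_right)
      finally show ?thesis using a
        by (simp add: V_def cscale_mul_right[symmetric] add_right cs.scaleR_right[symmetric] scaleR_add_right)
    qed
    show RV: "R z a \<in> V"
      using V_in qy qsy ry rsy norm2 by (auto simp: R_def)
    show "cscale z (R z a) - y \<odot> R z a = a"
    proof (cases "1 \<le> norm z")
      case True
      then have z: "z \<noteq> 0" by auto
      have Ra: "R z a = cscale (1/z) (a + q z \<odot> a)" using True by (simp add: R_def)
      have "y \<odot> R z a = cscale z (cscale (1/z) y \<odot> R z a)"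
        using z by (simp add: cscale_mul_left[symmetric] cscale_assoc)
      then have "cscale z (R z a) - y \<odot> R z a = cscale z (R z a - cscale (1/z) y \<odot> R z a)"
        by (simp only: cs.diff_right)
      also have "\<dots> = a"
        unfolding Ra ivl[OF q1[OF True]] using z by (simp add: cscale_assoc)
      finally show ?thesis .
    next
      case False
      define w where "w = 2 - z"
      note w = norm2[OF False, folded w_def]
      have z: "z = 2 - w" by (simp add: w_def)
      have Ra: "R z a = cscale (- 1/w) (a + r w \<odot> a)" using False by (simp add: R_def w_def)
      have "star y \<odot> R z a = cscale w (cscale (1/w) (star y) \<odot> R z a)"
        using w by (simp add: cscale_mul_left[symmetric] cscale_assoc)
      moreover have "cscale z (R z a) - y \<odot> R z a = - (cscale w (R z a) - star y \<odot> R z a)"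
      proof -
        have "cscale z (R z a) = 2 *\<^sub>R R z a - cscale w (R z a)"
          unfolding V2[symmetric] cs.diff_left[symmetric] by (simp add: w_def)
        then show ?thesis by (simp add: Vy[OF RV])
      qed
      ultimately have "cscale z (R z a) - y \<odot> R z a =
          - cscale w (R z a - cscale (1/w) (star y) \<odot> R z a)"
        by (simp only: cs.diff_right)
      also have "\<dots> = a"
        unfolding Ra ivl[OF r1[OF w(1)]] using w by (simp add: cscale_assoc cs.minus_left cs.minus_right)
      finally show ?thesis .
    qed
    show "R z (cscale z a - y \<odot> a) = a"
    proof (cases "1 \<le> norm z")
      case True
      then have z: "z \<noteq> 0" by auto
      have "cscale z a - y \<odot> a = cscale z (a - cscale (1/z) y \<odot> a)"
        using z by (simp add: cscale_mul_left[symmetric] cs_simps)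
      then have "R z (cscale z a - y \<odot> a) =
          (a - cscale (1/z) y \<odot> a) + q z \<odot> (a - cscale (1/z) y \<odot> a)"
        using z True
        by (simp add: R_def cscale_mul_right[symmetric] cscale_add_right[symmetric] cscale_assoc)
      then show ?thesis using ivr[OF q2[OF True]] by simp
    next
      case False
      define w where "w = 2 - z"
      note w = norm2[OF False, folded w_def]
      have z: "z = 2 - w" by (simp add: w_def)
      have "cscale z a - y \<odot> a = cscale (- w) (a - cscale (1/w) (star y) \<odot> a)"
        using w by (simp add: Vy[OF a] z V2 cscale_mul_left[symmetric] cs_simps)
      then have "R z (cscale z a - y \<odot> a) =
          (a - cscale (1/w) (star y) \<odot> a) + r w \<odot> (a - cscale (1/w) (star y) \<odot> a)"
        using w False
        by (simp add: R_def w_def[symmetric] cscale_mul_right[symmetric] cscale_add_right[symmetric]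
            cscale_assoc)
      then show ?thesis using ivr[OF r2[OF w(1)]] by simp
    qed
  next
    show "norm (y \<odot> a) \<le> norm y * norm a" for a by (rule norm_mul_le)
    \<comment> \<open>Since \<open>y\<close> and \<open>star y\<close> commute, (y + star y)(y -
      star y) is the difference of the squares 2 y - h and 2 star y - h, in which \<open>h\<close>
      cancels.\<close>
    show "y - star y \<in> V"
      by (simp add: V_def mul_simps yy sy yc algebra_simps)
  qed
  then have "star y = y" by simp
  with y(2) that show thesis by blast
qed

end

section \<open>Positive functionals: Cauchy-Schwarz and left multiplication\<close>

locale positive_functional_on_star = banach_star mul cscale star
  for mul :: "'a::banach \<Rightarrow> 'a \<Rightarrow> 'a" (infixl "\<odot>" 70)
    and cscale :: "complex \<Rightarrow> 'a \<Rightarrow> 'a" and star :: "'a \<Rightarrow> 'a" +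
  fixes \<phi> :: "'a \<Rightarrow> complex"
  assumes phi_add: "\<phi> (x + y) = \<phi> x + \<phi> y"
    and phi_cscale: "\<phi> (cscale c x) = c * \<phi> x"
    and phi_Reals: "\<phi> (star x \<odot> x) \<in> \<real>"
    and phi_nonneg: "0 \<le> Re (\<phi> (star x \<odot> x))"
begin

sublocale phi: linear \<phi>
proof
  show "\<phi> (r *\<^sub>R x) = r *\<^sub>R \<phi> x" for r x
    by (simp add: cscale_of_real[symmetric] phi_cscale scaleR_conv_of_real)
qed (rule phi_add)

definition p :: "'a \<Rightarrow> real" where
  "p x = Re (\<phi> (star x \<odot> x))"

lemma p_nonneg: "0 \<le> p x"
  by (simp add: p_def phi_nonneg)

lemma phi_star_mul_self: "\<phi> (star x \<odot> x) = of_real (p x)"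
  using phi_Reals by (simp add: p_def)

lemma p_cscale: "p (cscale c x) = (cmod c)\<^sup>2 * p x"
proof -
  have "star (cscale c x) \<odot> cscale c x = cscale (cnj c * c) (star x \<odot> x)"
    by (simp add: star_cscale cscale_mul_left[symmetric] cscale_mul_right[symmetric] cscale_assoc
        mult.commute)
  also have "cnj c * c = of_real ((cmod c)\<^sup>2)" by (simp only: complex_norm_square mult.commute)
  finally show ?thesis by (simp add: p_def phi_cscale)
qed

lemma p_scaleR: "p (r *\<^sub>R x) = r\<^sup>2 * p x"
  using p_cscale[of "of_real r" x] by (simp add: cscale_of_real)

lemma p_add: "p (x + y) = p x + p y + Re (\<phi> (star x \<odot> y) + \<phi> (star y \<odot> x))"
  by (simp add: p_def star_add mul_simps phi_add)

text \<open>Half of the parallelogram law; it avoids the square roots of the seminorm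
  inequality.\<close>

lemma p_add_le: "p (x + y) \<le> 2 * p x + 2 * p y"
proof -
  have "p (x + y) + p (x + - y) = 2 * p x + 2 * p y"
    unfolding p_add by (simp add: star.neg mul_simps phi.neg p_scaleR[of "-1", simplified])
  with p_nonneg[of "x + - y"] show ?thesis by linarith
qed

text \<open>Polarization: \<open>p\<close> is real at x + c y for c = 1 and c = \<i>. Without a unit
  this makes \<phi> hermitian only on products; the general case has to wait for
  factorization.\<close>

lemma phi_star_mul_commute: "\<phi> (star y \<odot> x) = cnj (\<phi> (star x \<odot> y))"
proof -
  have im: "Im (c * \<phi> (star x \<odot> y) + cnj c * \<phi> (star y \<odot> x)) = 0" for c
  proof -
    have "\<phi> (star (x + cscale c y) \<odot> (x + cscale c y)) = of_real (p x) + of_real (p (cscale c y))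
        + (\<phi> (star x \<odot> cscale c y) + \<phi> (star (cscale c y) \<odot> x))"
      by (simp only: star_add add_left add_right phi_add phi_star_mul_self ac_simps)
    also have "\<phi> (star x \<odot> cscale c y) + \<phi> (star (cscale c y) \<odot> x) =
        c * \<phi> (star x \<odot> y) + cnj c * \<phi> (star y \<odot> x)"
      by (simp add: star_cscale cscale_mul_left[symmetric] cscale_mul_right[symmetric] phi_cscale)
    finally show ?thesis
      unfolding phi_star_mul_self by (auto dest: arg_cong[where f=Im])
  qed
  from im[of 1] im[of \<i>] show ?thesis by (simp add: complex_eq_iff)
qed

lemma cauchy_schwarz: "(cmod (\<phi> (star x \<odot> y)))\<^sup>2 \<le> p x * p y"
proof -
  \<comment> \<open>A phase turning the value into its modulus. It is 0 if the value is 0, whence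
    only \<open>cmod s \<le> 1\<close>.\<close>
  define s where "s = cnj (sgn (\<phi> (star x \<odot> y)))"
  have s: "s * \<phi> (star x \<odot> y) = of_real (cmod (\<phi> (star x \<odot> y)))"
    by (simp add: s_def sgn_eq complex_norm_square[symmetric] power2_eq_square mult.commute)
  have s1: "cmod s \<le> 1" by (simp add: s_def norm_sgn)
  let ?m = "cmod (\<phi> (star x \<odot> y))"
  have "0 \<le> p x + 2 * t * ?m + t\<^sup>2 * p y" for t
  proof -
    have a: "\<phi> (star x \<odot> cscale (of_real t * s) y) = of_real (t * ?m)"
      by (simp add: cscale_mul_right[symmetric] phi_cscale mult.assoc s)
    have "0 \<le> p (x + cscale (of_real t * s) y)" by (rule p_nonneg)
    also have "\<dots> = p x + (cmod (of_real t * s))\<^sup>2 * p y + 2 * t * ?m"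
      unfolding p_add phi_star_mul_commute[of _ x] a by (simp add: p_cscale)
    also have "(cmod (of_real t * s))\<^sup>2 * p y \<le> t\<^sup>2 * p y"
      using s1 by (intro mult_right_mono p_nonneg)
        (simp add: norm_mult power_mult_distrib mult_left_le power_le_one)
    finally show ?thesis by simp
  qed
  note quad = this
  show ?thesis
  proof (cases "p y = 0")
    case True
    have "?m = 0"
    proof (rule ccontr)
      assume "?m \<noteq> 0"
      then show False using quad[of "- (p x + 1) / (2 * ?m)"] True by (simp add: field_simps)
    qed
    then show ?thesis using True by simp
  next
    case False
    then have py: "p y > 0" using p_nonneg[of y] by simp
    have "0 \<le> p y * (p x + 2 * (- ?m / p y) * ?m + (- ?m / p y)\<^sup>2 * p y)"
      using quad[of "- ?m / p y"] py by (intro mult_nonneg_nonneg) auto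
    also have "\<dots> = p x * p y - ?m\<^sup>2"
      using py by (simp add: field_simps power2_eq_square)
    finally show ?thesis by simp
  qed
qed

text \<open>If 1 - h is the square of 1 - y with \<open>y\<close> hermitian, then
  \<open>p (b - y \<odot> b)\<close> equals \<open>p b\<close> minus the left-hand side, and it is
  nonnegative.\<close>

lemma phi_star_hermitian_le:
  assumes h: "star h = h"
  shows "Re (\<phi> (star b \<odot> (h \<odot> b))) \<le> norm h * p b"
proof -
  have unit: "Re (\<phi> (star b \<odot> (h \<odot> b))) \<le> p b" if h: "star h = h" and n: "norm h < 1" for h
  proof -
    obtain y where y: "star y = y" "2 *\<^sub>R y - y \<odot> y = h"
      using hermitian_quasi_square_root[OF h n] by metis
    have "star (b - y \<odot> b) \<odot> (b - y \<odot> b) = star b \<odot> b - star b \<odot> ((2 *\<^sub>R y - y \<odot> y) \<odot> b)"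
      by (simp add: star.diff star_mul y(1) mul_simps algebra_simps scaleR_2)
    then have "p (b - y \<odot> b) = p b - Re (\<phi> (star b \<odot> (h \<odot> b)))"
      by (simp add: y(2) p_def phi.diff)
    with p_nonneg show ?thesis by (metis diff_ge_0_iff_ge)
  qed
  have "Re (\<phi> (star b \<odot> (h \<odot> b))) \<le> norm h * p b + \<epsilon>" if "\<epsilon> > 0" for \<epsilon>
  proof -
    define \<delta> where "\<delta> = \<epsilon> / (p b + 1)"
    have pb: "p b + 1 > 0" using p_nonneg[of b] by simp
    then have \<delta>: "\<delta> > 0" using that by (simp add: \<delta>_def)
    \<comment> \<open>The root lemma needs norm strictly below 1, so \<open>h\<close> is divided by
      slightly more than its norm.\<close>
    define c where "c = norm h + \<delta>"
    have c: "c > 0" using \<delta> by (simp add: c_def add_nonneg_pos)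
    have "Re (\<phi> (star b \<odot> (((1/c) *\<^sub>R h) \<odot> b))) \<le> p b"
      using c \<delta> by (intro unit) (auto simp: star.scaleR h c_def)
    then have "Re (\<phi> (star b \<odot> (h \<odot> b))) / c \<le> p b"
      by (simp add: mul_simps phi.scaleR)
    then have "Re (\<phi> (star b \<odot> (h \<odot> b))) \<le> norm h * p b + \<delta> * p b"
      using c by (simp add: pos_divide_le_eq c_def algebra_simps)
    also have "\<delta> * p b \<le> \<epsilon>"
      using pb that by (simp add: \<delta>_def field_simps)
    finally show ?thesis by simp
  qed
  then show ?thesis by (rule field_le_epsilon)
qed

lemma p_mul_le_star: "p (x \<odot> b) \<le> norm (star x) * norm x * p b"
proof -
  have "p (x \<odot> b) = Re (\<phi> (star b \<odot> ((star x \<odot> x) \<odot> b)))"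
    by (simp add: p_def star_mul assoc)
  also have "\<dots> \<le> norm (star x \<odot> x) * p b"
    by (rule phi_star_hermitian_le) (simp add: star_mul)
  also have "\<dots> \<le> norm (star x) * norm x * p b"
    by (intro mult_right_mono norm_mul_le p_nonneg)
  finally show ?thesis .
qed

end

section \<open>Two Banach space tools: Baire category and summable increments\<close>

text \<open>By Baire, the closure of some set where \<open>norm (T x) \<le> n\<close> contains a
  ball. Differences of points of that set near \<open>c + t *\<^sub>R a\<close> and near
  \<open>c\<close> approximate \<open>t *\<^sub>R a\<close>, with images of norm at most 2
  n.\<close>

lemma linear_bounded_on_dense:
  fixes T :: "'a::banach \<Rightarrow> 'b::real_normed_vector"
  assumes "linear T"
  obtains C where "C \<ge> 0" "\<And>a \<epsilon>. \<epsilon> > 0 \<Longrightarrow> \<exists>s. norm (s - a) < \<epsilon> \<and> norm (T s) \<le> C * norm a"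
proof -
  interpret T: linear T by fact
  define F where "F n = closure {x. norm (T x) \<le> real n}" for n
  have "\<Union> (range F) = UNIV"
  proof -
    have "x \<in> F (nat \<lceil>norm (T x)\<rceil>)" for x
      unfolding F_def by (rule subsetD[OF closure_subset]) (simp add: of_nat_ceiling)
    then show ?thesis by blast
  qed
  then have "\<exists>n. interior (F n) \<noteq> {}"
    using Met_TC.metric_Baire_category_alt[where 'a='a, of "range F"]
    by (auto simp: F_def complete_UNIV)
  then obtain n c r where r: "r > 0" "ball c r \<subseteq> F n"
    by (auto simp: mem_interior)
  have near: "\<exists>s. norm (s - x) < \<epsilon> \<and> norm (T s) \<le> n" if "norm (x - c) < r" "\<epsilon> > 0" for x \<epsilon>
  proof -
    have "x \<in> F n" using r(2) that(1) by (auto simp: dist_norm norm_minus_commute)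
    with that(2) show ?thesis by (fastforce simp: F_def closure_approachable dist_norm)
  qed
  show thesis
  proof (rule that)
    show "0 \<le> 4 * n / r" using r by simp
    fix a :: 'a and \<epsilon> :: real assume \<epsilon>: "\<epsilon> > 0"
    show "\<exists>s. norm (s - a) < \<epsilon> \<and> norm (T s) \<le> 4 * n / r * norm a"
    proof (cases "a = 0")
      case True
      with \<epsilon> show ?thesis by (intro exI[of _ 0]) (simp add: T.zero)
    next
      case False
      \<comment> \<open>This places \<open>c + t *\<^sub>R a\<close> at distance r / 2 from
        \<open>c\<close>; dividing 2 n by \<open>t\<close> yields the constant 4 n / r.\<close>
      define t where "t = r / (2 * norm a)"
      have t: "t > 0" using r False by (simp add: t_def)
      obtain s1 where s1: "norm (s1 - (c + t *\<^sub>R a)) < t * \<epsilon> / 2" "norm (T s1) \<le> n"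
        using near[of "c + t *\<^sub>R a" "t * \<epsilon> / 2"] t \<epsilon> r False by (auto simp: t_def)
      obtain s2 where s2: "norm (s2 - c) < t * \<epsilon> / 2" "norm (T s2) \<le> n"
        using near[of c "t * \<epsilon> / 2"] t \<epsilon> r by auto
      let ?s = "(1/t) *\<^sub>R (s1 - s2)"
      have "norm ((s1 - s2) - t *\<^sub>R a) < t * \<epsilon>"
        using s1(1) s2(1) norm_triangle_ineq4[of "s1 - (c + t *\<^sub>R a)" "s2 - c"]
        by (simp add: algebra_simps)
      moreover have "?s - a = (1/t) *\<^sub>R ((s1 - s2) - t *\<^sub>R a)"
        using t by (simp add: scaleR_diff_right)
      ultimately have "norm (?s - a) < \<epsilon>"
        using t by (simp add: pos_divide_less_eq mult.commute)
      moreover have "norm (T s1 - T s2) \<le> 2 * n"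
        using norm_triangle_ineq4[of "T s1" "T s2"] s1(2) s2(2) by linarith
      then have "norm (T ?s) \<le> 2 * n / t"
        using t by (simp add: T.scaleR T.diff divide_right_mono)
      then have "norm (T ?s) \<le> 4 * n / r * norm a"
        by (simp add: t_def)
      ultimately show ?thesis by blast
    qed
  qed
qed

text \<open>The tail bound depends only on \<open>g\<close>, so a family of sequences with common
  \<open>g\<close> converges uniformly; this is how the Cohen quotients stay a null
  sequence.\<close>

lemma convergent_if_summable_increments:
  fixes x :: "nat \<Rightarrow> 'a::banach"
  assumes le: "\<And>n. norm (x (Suc n) - x n) \<le> g n" and g: "summable g"
  obtains l where "x \<longlonglongrightarrow> l" "\<And>n. norm (l - x n) \<le> (\<Sum>i. g (i + n))"
proof -
  have s: "summable (\<lambda>n. norm (x (Suc n) - x n))"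
    using le by (intro summable_comparison_test'[OF g, of 0]) simp
  obtain d where d: "(\<lambda>n. x (Suc n) - x n) sums d"
    using summable_sums[OF summable_norm_cancel[OF s]] by (rule that)
  then have "(\<lambda>n. x n - x 0) \<longlonglongrightarrow> d"
    unfolding sums_def sum_lessThan_telescope .
  from tendsto_add[OF tendsto_const[of "x 0"] this] have lim: "x \<longlonglongrightarrow> x 0 + d" by simp
  show thesis
  proof (rule that[OF lim])
    fix n
    have "(\<lambda>m. \<Sum>i<m. x (Suc (i + n)) - x (i + n)) = (\<lambda>m. x (m + n) - x n)"
      using sum_lessThan_telescope[of "\<lambda>i. x (i + n)"] by (simp add: fun_eq_iff)
    moreover have "(\<lambda>m. x (m + n) - x n) \<longlonglongrightarrow> x 0 + d - x n"
      by (intro tendsto_diff tendsto_const LIMSEQ_ignore_initial_segment lim)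
    ultimately have "(\<lambda>i. x (Suc (i + n)) - x (i + n)) sums (x 0 + d - x n)"
      by (simp add: sums_def)
    then have "x 0 + d - x n = (\<Sum>i. x (Suc (i + n)) - x (i + n))" by (rule sums_unique)
    also have "norm \<dots> \<le> (\<Sum>i. norm (x (Suc (i + n)) - x (i + n)))"
      using s by (intro summable_norm) (simp add: summable_iff_shift[of "\<lambda>n. norm (x (Suc n) - x n)"])
    also have "\<dots> \<le> (\<Sum>i. g (i + n))"
      using s g le
      by (intro suminf_le)
        (simp_all add: summable_iff_shift[of "\<lambda>n. norm (x (Suc n) - x n)"] summable_iff_shift[of g])
    finally show "norm (x 0 + d - x n) \<le> (\<Sum>i. g (i + n))" .
  qed
qed

section \<open>Cohen factorization of null sequences\<close>

context banach_mult
begin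

text \<open>A net-free form of a right approximate unit bounded by \<open>M\<close>.\<close>

definition right_bounded_units :: "real \<Rightarrow> bool" where
  "right_bounded_units M \<longleftrightarrow>
    (\<forall>F \<epsilon>. finite F \<longrightarrow> \<epsilon> > 0 \<longrightarrow> (\<exists>e. norm e \<le> M \<and> (\<forall>a\<in>F. norm (a \<odot> e - a) < \<epsilon>)))"

lemma right_bounded_unitsD:
  assumes "right_bounded_units M" "finite F" "\<epsilon> > 0"
  obtains e where "norm e \<le> M" "\<And>a. a \<in> F \<Longrightarrow> norm (a \<odot> e - a) < \<epsilon>"
  using assms unfolding right_bounded_units_def by blast

lemma right_bounded_units_nonneg:
  assumes "right_bounded_units M" shows "M \<ge> 0"
  using right_bounded_unitsD[OF assms, of "{}" 1] by (metis finite.emptyI norm_ge_zero order_trans zero_less_one)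

text \<open>One unit serves all terms: finitely many are handled by the definition, and the tail is
  so small that \<open>norm e \<le> M\<close> suffices.\<close>

lemma right_bounded_units_null_sequence:
  assumes au: "right_bounded_units M" and a: "a \<longlonglongrightarrow> 0" and \<epsilon>: "\<epsilon> > 0"
  obtains e where "norm e \<le> M" "norm (x \<odot> e - x) \<le> \<epsilon>" "\<And>k. norm (a k \<odot> e - a k) \<le> \<epsilon>"
proof -
  have M: "M \<ge> 0" by (rule right_bounded_units_nonneg[OF au])
  then have "\<epsilon> / (M + 1) > 0" using \<epsilon> by simp
  then obtain N where N: "\<And>k. k \<ge> N \<Longrightarrow> norm (a k) < \<epsilon> / (M + 1)"
    using a unfolding LIMSEQ_iff by (metis diff_zero)
  obtain e where e: "norm e \<le> M" "\<And>b. b \<in> insert x (a ` {..<N}) \<Longrightarrow> norm (b \<odot> e - b) < \<epsilon>"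
    using right_bounded_unitsD[OF au _ \<epsilon>, of "insert x (a ` {..<N})"] by auto
  have "norm (a k \<odot> e - a k) \<le> \<epsilon>" for k
  proof (cases "k < N")
    case True
    then show ?thesis using e(2)[of "a k"] by simp
  next
    case False
    have "norm (a k \<odot> e - a k) \<le> norm (a k) * norm e + norm (a k)"
      by (rule order_trans[OF norm_triangle_ineq4]) (simp add: norm_mul_le)
    also have "\<dots> \<le> norm (a k) * (M + 1)"
      using mult_left_mono[OF e(1), of "norm (a k)"] by (simp add: algebra_simps)
    also have "\<dots> \<le> \<epsilon>"
      using N[of k] False M by (simp add: pos_less_divide_eq)
    finally show ?thesis .
  qed
  with e(1) e(2)[of x] show thesis by (intro that) auto
qed

text \<open>\<open>Z\<close> is right multiplication by the inverse of 1 - \<gamma> + \<gamma> e in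
  the unitization. The formula for \<open>Z v - v\<close> shows that \<open>Z\<close> barely moves
  those \<open>v\<close> on which \<open>e\<close> acts almost as a right unit.\<close>

lemma right_inverse_operator:
  assumes \<gamma>: "0 < \<gamma>" "\<gamma> \<le> 1/2" and e: "\<gamma> * norm e \<le> (1 - \<gamma>) / 2"
  obtains Z where "bounded_linear Z" "\<And>v. (1 - \<gamma>) *\<^sub>R Z v + \<gamma> *\<^sub>R (Z v \<odot> e) = v"
    "\<And>v. Z v - v = \<gamma> *\<^sub>R Z (v - v \<odot> e)" "\<And>v. norm (Z v) \<le> 4 * norm v"
proof -
  \<comment> \<open>Chosen so that 1 - \<gamma> + \<gamma> e = (1 - \<gamma>)(1 - f), with
    \<open>norm f\<close> at most 1/2.\<close>
  define f where "f = (- (\<gamma> / (1 - \<gamma>))) *\<^sub>R e"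
  have f: "norm f \<le> 1/2"
    using \<gamma> e by (simp add: f_def divide_le_eq)
  have "(- (1 - \<gamma>)) * (- (\<gamma> / (1 - \<gamma>))) = \<gamma>" using \<gamma> by (simp add: field_simps)
  then have ef: "\<gamma> *\<^sub>R e = (- (1 - \<gamma>)) *\<^sub>R f" by (simp only: f_def scaleR_scaleR)
  obtain q where q: "q = f + f \<odot> q" "q = f + q \<odot> f" "\<And>z. z \<odot> f = f \<odot> z \<Longrightarrow> z \<odot> q = q \<odot> z"
    "norm q \<le> norm f + norm f * norm q"
    by (rule quasi_inverse[of f]) (use f in auto)
  have "norm q \<le> 1"
    using q(4) f mult_right_mono[OF f, of "norm q"] by simp
  define Z where "Z v = (1 / (1 - \<gamma>)) *\<^sub>R (v + v \<odot> q)" for v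
  have Zlin: "bounded_linear Z"
    unfolding Z_def
    by (intro bounded_linear_scaleR_right[THEN bounded_linear_compose] bounded_linear_add
        bounded_linear_ident bounded_linear_left)
  then interpret Z: bounded_linear Z .
  have Zg: "(1 - \<gamma>) *\<^sub>R Z v = v + v \<odot> q" for v using \<gamma> by (simp add: Z_def)
  have eZ: "\<gamma> *\<^sub>R (v \<odot> e) = - ((1 - \<gamma>) *\<^sub>R (v \<odot> f))" for v
    using arg_cong[OF ef, of "\<lambda>x. v \<odot> x"] by (simp only: scaleR_right scaleR_minus_left minus_right)
  show thesis
  proof (rule that[OF Zlin])
    fix v
    have vq: "v \<odot> q = v \<odot> f + v \<odot> (q \<odot> f)" "v \<odot> q = v \<odot> f + v \<odot> (f \<odot> q)"
      using arg_cong[OF q(2), of "\<lambda>x. v \<odot> x"] arg_cong[OF q(1), of "\<lambda>x. v \<odot> x"]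
      by (simp_all only: add_right)
    have "(1 - \<gamma>) *\<^sub>R Z v + \<gamma> *\<^sub>R (Z v \<odot> e) = (1 - \<gamma>) *\<^sub>R Z v - ((1 - \<gamma>) *\<^sub>R Z v) \<odot> f"
      by (simp only: eZ scaleR_left) simp
    also have "\<dots> = v + v \<odot> q - (v \<odot> f + v \<odot> (q \<odot> f))"
      by (simp only: Zg add_left assoc)
    finally show "(1 - \<gamma>) *\<^sub>R Z v + \<gamma> *\<^sub>R (Z v \<odot> e) = v" using vq(1) by simp
    have "(1 - \<gamma>) *\<^sub>R Z v + \<gamma> *\<^sub>R Z (v \<odot> e) = (1 - \<gamma>) *\<^sub>R Z v - (1 - \<gamma>) *\<^sub>R Z (v \<odot> f)"
      by (simp only: Z.scaleR[symmetric] eZ Z.neg) simp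
    also have "\<dots> = v + v \<odot> q - (v \<odot> f + v \<odot> (f \<odot> q))"
      by (simp only: Zg assoc)
    finally have "(1 - \<gamma>) *\<^sub>R Z v + \<gamma> *\<^sub>R Z (v \<odot> e) = v" using vq(2) by simp
    then show "Z v - v = \<gamma> *\<^sub>R Z (v - v \<odot> e)"
      by (simp add: Z.diff algebra_simps)
    have "norm (v + v \<odot> q) \<le> norm v + norm v * norm q"
      by (rule order_trans[OF norm_triangle_ineq]) (simp add: norm_mul_le)
    also have "\<dots> \<le> 2 * norm v" using mult_left_mono[OF \<open>norm q \<le> 1\<close>, of "norm v"] by simp
    finally have "norm (v + v \<odot> q) / (1 - \<gamma>) \<le> 2 * norm v / (1/2)"
      using \<gamma> by (intro frac_le) auto
    then show "norm (Z v) \<le> 4 * norm v" using \<gamma> by (simp add: Z_def)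
  qed
qed

text \<open>Cohen's factorization. In the unitization, \<open>u n = x n + (1 - \<gamma>) ^ n\<close> is the product of the
  factors \<open>1 - \<gamma> + \<gamma> e\<close> chosen so far and \<open>T n\<close> is right multiplication by its inverse.
  The limit of \<open>u n\<close> lies in the algebra although no \<open>u n\<close> does.\<close>

lemma null_sequence_factorization:
  assumes au: "right_bounded_units M" and a: "a \<longlonglongrightarrow> 0"
  obtains b c where "c \<longlonglongrightarrow> 0" "\<And>k. a k = c k \<odot> b"
proof -
  have M: "M \<ge> 0" by (rule right_bounded_units_nonneg[OF au])
  \<comment> \<open>Small enough that every factor 1 - \<gamma> + \<gamma> e with
    \<open>norm e \<le> M\<close> is invertible by the preceding construction.\<close>
  define \<gamma> where "\<gamma> = 1 / (2 * M + 2)"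
  have \<gamma>: "0 < \<gamma>" "\<gamma> \<le> 1/2" "\<gamma> * M \<le> (1 - \<gamma>) / 2"
    using M by (simp_all add: \<gamma>_def field_simps)
  define P where "P n xT \<longleftrightarrow> bounded_linear (snd xT) \<and>
    (\<forall>v. snd xT v \<odot> fst xT + (1 - \<gamma>) ^ n *\<^sub>R snd xT v = v)" for n and xT :: "'a \<times> ('a \<Rightarrow> 'a)"
  define Q where "Q n xT yS \<longleftrightarrow> norm (fst yS - fst xT) \<le> (1/2) ^ n + M * (1 - \<gamma>) ^ n \<and>
    (\<forall>k. norm (snd yS (a k) - snd xT (a k)) \<le> (1/2) ^ n)" for n and xT yS :: "'a \<times> ('a \<Rightarrow> 'a)"
  have "\<exists>u. \<forall>n. P n (u n) \<and> Q n (u n) (u (Suc n))"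
  proof (rule dependent_nat_choice)
    show "\<exists>xT. P 0 xT"
      by (rule exI[of _ "(0, \<lambda>v. v)"]) (simp add: P_def zero_right bounded_linear_ident)
    fix xT n assume "P n xT"
    then obtain x T where xT: "xT = (x, T)" and T: "bounded_linear T"
      and inv: "\<And>v. T v \<odot> x + (1 - \<gamma>) ^ n *\<^sub>R T v = v"
      unfolding P_def by (cases xT) auto
    interpret T: bounded_linear T by fact
    obtain B where B: "B > 0" "\<And>v. norm (T v) \<le> norm v * B" using T.pos_bounded by blast
    \<comment> \<open>The bound \<open>B\<close> of the inverse built so far is known before
      \<open>e\<close> is chosen, so it can be compensated; the 4 compensates the bound of
      \<open>Z\<close>.\<close>
    define \<epsilon> where "\<epsilon> = min 1 (1 / (4 * B)) * (1/2) ^ n"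
    have \<epsilon>: "\<epsilon> > 0" "\<epsilon> \<le> (1/2) ^ n" "\<epsilon> * (4 * B) \<le> (1/2) ^ n"
    proof -
      show "\<epsilon> > 0" "\<epsilon> \<le> (1/2) ^ n" using B(1) by (auto simp: \<epsilon>_def mult_left_le_one_le)
      have "\<epsilon> \<le> 1 / (4 * B) * (1/2) ^ n" unfolding \<epsilon>_def by (intro mult_right_mono) auto
      then show "\<epsilon> * (4 * B) \<le> (1/2) ^ n" using B(1) by (simp add: field_simps)
    qed
    obtain e where e: "norm e \<le> M" "norm (x \<odot> e - x) \<le> \<epsilon>" "\<And>k. norm (a k \<odot> e - a k) \<le> \<epsilon>"
      using right_bounded_units_null_sequence[OF au a \<epsilon>(1)] by metis
    have "\<gamma> * norm e \<le> (1 - \<gamma>) / 2"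
      using \<gamma> mult_left_mono[OF e(1), of \<gamma>] by linarith
    then obtain Z where Z: "bounded_linear Z" "\<And>v. (1 - \<gamma>) *\<^sub>R Z v + \<gamma> *\<^sub>R (Z v \<odot> e) = v"
      "\<And>v. Z v - v = \<gamma> *\<^sub>R Z (v - v \<odot> e)" "\<And>v. norm (Z v) \<le> 4 * norm v"
      using right_inverse_operator[OF \<gamma>(1,2)] by metis
    \<comment> \<open>The algebra part of (x + (1 - \<gamma>)^n)(1 - \<gamma> + \<gamma> e); its
      scalar part is (1 - \<gamma>)^(n + 1).\<close>
    define y where "y = (1 - \<gamma>) *\<^sub>R x + \<gamma> *\<^sub>R (x \<odot> e) + (\<gamma> * (1 - \<gamma>) ^ n) *\<^sub>R e"
    have "P (Suc n) (y, \<lambda>v. T (Z v))"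
    proof -
      have "T (Z v) \<odot> y + (1 - \<gamma>) ^ Suc n *\<^sub>R T (Z v) = v" for v
      proof -
        let ?w = "T (Z v) \<odot> x + (1 - \<gamma>) ^ n *\<^sub>R T (Z v)"
        have "T (Z v) \<odot> y + (1 - \<gamma>) ^ Suc n *\<^sub>R T (Z v) = (1 - \<gamma>) *\<^sub>R ?w + \<gamma> *\<^sub>R (?w \<odot> e)"
          by (simp add: y_def add_left add_right scaleR_left scaleR_right assoc scaleR_add_right)
        then show ?thesis by (simp only: inv Z(2))
      qed
      then show ?thesis
        using bounded_linear_compose[OF T Z(1)] by (simp add: P_def)
    qed
    moreover have "Q n xT (y, \<lambda>v. T (Z v))"
    proof -
      have "y - x = \<gamma> *\<^sub>R (x \<odot> e - x) + (\<gamma> * (1 - \<gamma>) ^ n) *\<^sub>R e"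
        by (simp add: y_def algebra_simps)
      then have "norm (y - x) \<le> \<gamma> * norm (x \<odot> e - x) + \<gamma> * (1 - \<gamma>) ^ n * norm e"
        using \<gamma> norm_triangle_ineq[of "\<gamma> *\<^sub>R (x \<odot> e - x)" "(\<gamma> * (1 - \<gamma>) ^ n) *\<^sub>R e"]
        by (simp add: abs_mult power_abs)
      also have "\<dots> \<le> 1 * (1/2) ^ n + 1 * (1 - \<gamma>) ^ n * M"
        using \<gamma> e \<epsilon> by (intro add_mono mult_mono) auto
      finally have "norm (y - x) \<le> (1/2) ^ n + M * (1 - \<gamma>) ^ n" by (simp add: mult.commute)
      moreover have "norm (T (Z (a k)) - T (a k)) \<le> (1/2) ^ n" for k
      proof -
        have "norm (T (Z (a k)) - T (a k)) = norm (T (Z (a k) - a k))" by (simp add: T.diff)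
        also have "\<dots> \<le> norm (Z (a k) - a k) * B" by (rule B(2))
        also have "\<dots> = \<gamma> * norm (Z (a k - a k \<odot> e)) * B" using \<gamma> by (simp add: Z(3))
        also have "\<dots> \<le> 1 * (4 * \<epsilon>) * B"
        proof (intro mult_right_mono mult_mono)
          show "norm (Z (a k - a k \<odot> e)) \<le> 4 * \<epsilon>"
            using Z(4)[of "a k - a k \<odot> e"] e(3)[of k] by (simp add: norm_minus_commute)
        qed (use \<gamma> B in auto)
        also have "\<dots> \<le> (1/2) ^ n" using \<epsilon>(3) by (simp add: mult_ac)
        finally show ?thesis .
      qed
      ultimately show ?thesis by (simp add: Q_def xT)
    qed
    ultimately show "\<exists>yS. P (Suc n) yS \<and> Q n xT yS" by blast
  qed
  then obtain u where u: "\<And>n. P n (u n)" "\<And>n. Q n (u n) (u (Suc n))" by blast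
  define x where "x n = fst (u n)" for n
  define T where "T n = snd (u n)" for n
  have T: "bounded_linear (T n)" and inv: "T n v \<odot> x n + (1 - \<gamma>) ^ n *\<^sub>R T n v = v"
    and dx: "norm (x (Suc n) - x n) \<le> (1/2) ^ n + M * (1 - \<gamma>) ^ n"
    and dT: "norm (T (Suc n) (a k) - T n (a k)) \<le> (1/2) ^ n" for n v k
    using u[of n] by (auto simp: P_def Q_def x_def T_def)
  have "summable (\<lambda>n. (1/2) ^ n + M * (1 - \<gamma>) ^ n)"
    using \<gamma> by (intro summable_add summable_mult summable_geometric) auto
  then obtain b where b: "x \<longlonglongrightarrow> b"
    using convergent_if_summable_increments[of x, OF dx] by metis
  have "\<exists>c. (\<lambda>n. T n (a k)) \<longlonglongrightarrow> c \<and> (\<forall>n. norm (c - T n (a k)) \<le> 2 * (1/2) ^ n)" for k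
  proof -
    have "summable (\<lambda>n. (1/2::real) ^ n)" by (intro summable_geometric) auto
    then obtain c where "(\<lambda>n. T n (a k)) \<longlonglongrightarrow> c"
      and le: "\<And>n. norm (c - T n (a k)) \<le> (\<Sum>i. (1/2) ^ (i + n))"
      using convergent_if_summable_increments[of "\<lambda>n. T n (a k)", OF dT] by metis
    moreover have "(\<Sum>i. (1/2::real) ^ (i + n)) = 2 * (1/2) ^ n" for n
      using suminf_mult2[of "\<lambda>i. (1/2::real) ^ i" "(1/2) ^ n"] suminf_geometric[of "1/2::real"]
        summable_geometric[of "1/2::real"]
      by (simp add: power_add)
    ultimately show ?thesis by auto
  qed
  then obtain c where c: "\<And>k. (\<lambda>n. T n (a k)) \<longlonglongrightarrow> c k"
    and cT: "\<And>k n. norm (c k - T n (a k)) \<le> 2 * (1/2) ^ n"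
    by metis
  show thesis
  proof (rule that)
    fix k
    have "(\<lambda>n. (1 - \<gamma>) ^ n) \<longlonglongrightarrow> 0" using \<gamma> by (intro LIMSEQ_realpow_zero) auto
    then have "(\<lambda>n. T n (a k) \<odot> x n + (1 - \<gamma>) ^ n *\<^sub>R T n (a k)) \<longlonglongrightarrow> c k \<odot> b + 0 *\<^sub>R c k"
      by (intro tendsto_add tendsto tendsto_scaleR c b)
    then have "(\<lambda>n. a k) \<longlonglongrightarrow> c k \<odot> b" by (simp add: inv)
    then show "a k = c k \<odot> b" by (simp add: LIMSEQ_const_iff)
  next
    \<comment> \<open>For fixed \<open>n\<close> the sequence \<open>T n (a k)\<close> is null in
      \<open>k\<close>, and \<open>cT\<close> makes it close to \<open>c k\<close> uniformly in
      \<open>k\<close>.\<close>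
    show "c \<longlonglongrightarrow> 0"
    proof (rule LIMSEQ_I)
      fix \<epsilon> :: real assume \<epsilon>: "\<epsilon> > 0"
      obtain n where n: "(1/2::real) ^ n < \<epsilon> / 4"
        using real_arch_pow_inv[of "\<epsilon> / 4" "1/2"] \<epsilon> by auto
      have "(\<lambda>k. T n (a k)) \<longlonglongrightarrow> 0"
        using bounded_linear.tendsto_zero[OF T a] .
      then obtain N where N: "\<And>k. k \<ge> N \<Longrightarrow> norm (T n (a k)) < \<epsilon> / 2"
        using \<epsilon> unfolding LIMSEQ_iff by (metis diff_zero half_gt_zero)
      show "\<exists>N. \<forall>k\<ge>N. norm (c k - 0) < \<epsilon>"
      proof (intro exI allI impI)
        fix k assume "N \<le> k"
        with N[of k] cT[of k n] n norm_triangle_sub[of "c k" "T n (a k)"]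
        show "norm (c k - 0) < \<epsilon>" by simp
      qed
    qed
  qed
qed

corollary factorization:
  assumes "right_bounded_units M"
  obtains b c where "x = c \<odot> b"
proof -
  have "(\<lambda>n. if n = (0::nat) then x else 0) \<longlonglongrightarrow> 0"
    by (rule tendsto_eventually) (auto simp: eventually_sequentially intro!: exI[of _ 1])
  then obtain b c where "\<And>n. (if n = (0::nat) then x else 0) = c n \<odot> b"
    using null_sequence_factorization[OF assms] by blast
  from this[of 0] show thesis using that by simp
qed

end

section \<open>From factorization to finite variation and continuity\<close>

context positive_functional_on_star
begin

text \<open>The involution may be unbounded, but by Baire it is bounded along a sequence approaching
  any given \<open>a\<close>; the error term in \<open>p_mul_le_star\<close> is killed by the factor \<open>norm x\<close>.\<close>

lemma p_mul_le:
  obtains C where "C \<ge> 0" "\<And>a b. p (a \<odot> b) \<le> C * (norm a)\<^sup>2 * p b"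
proof -
  obtain C where C: "C \<ge> 0" "\<And>a \<epsilon>. \<epsilon> > 0 \<Longrightarrow> \<exists>s. norm (s - a) < \<epsilon> \<and> norm (star s) \<le> C * norm a"
    using linear_bounded_on_dense[OF star.linear_axioms] by metis
  show thesis
  proof (rule that)
    show "0 \<le> 2 * C" using C by simp
    fix a b
    \<comment> \<open>Collects the coefficients of \<delta> in the final estimate, fixed before
      \<delta> is chosen.\<close>
    define D where "D = (2 * C * norm a + 2 * (norm (star a) + C * norm a)) * p b"
    have D: "D \<ge> 0" using C p_nonneg by (simp add: D_def)
    show "p (a \<odot> b) \<le> 2 * C * (norm a)\<^sup>2 * p b"
    proof (rule field_le_epsilon)
      fix \<epsilon> :: real assume "\<epsilon> > 0"
      define \<delta> where "\<delta> = \<epsilon> / (D + 1)"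
      have \<delta>: "\<delta> > 0" "\<delta> * D \<le> \<epsilon>"
        using \<open>\<epsilon> > 0\<close> D by (simp_all add: \<delta>_def field_simps)
      obtain s where s: "norm (s - a) < \<delta>" "norm (star s) \<le> C * norm a"
        using C(2)[OF \<delta>(1)] by blast
      have ns: "norm s \<le> norm a + \<delta>" using s(1) norm_triangle_sub[of s a] by linarith
      have nas: "norm (a - s) \<le> \<delta>" using s(1) by (simp add: norm_minus_commute)
      have "norm (star (a - s)) \<le> norm (star a) + C * norm a"
        using s(2) norm_triangle_ineq4[of "star a" "star s"] by (simp add: star.diff)
      then have 1: "norm (star (a - s)) * norm (a - s) * p b \<le> (norm (star a) + C * norm a) * \<delta> * p b"
        using nas C p_nonneg by (intro mult_mono mult_right_mono) auto
      have 2: "norm (star s) * norm s * p b \<le> C * norm a * (norm a + \<delta>) * p b"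
        using s ns C p_nonneg by (intro mult_mono mult_right_mono) auto
      have "p (a \<odot> b) \<le> 2 * p (s \<odot> b) + 2 * p ((a - s) \<odot> b)"
        using p_add_le[of "s \<odot> b" "(a - s) \<odot> b"] by (simp add: diff_left)
      also have "\<dots> \<le> 2 * (C * norm a * (norm a + \<delta>) * p b)
          + 2 * ((norm (star a) + C * norm a) * \<delta> * p b)"
        using p_mul_le_star[of s b] p_mul_le_star[of "a - s" b] 1 2 by linarith
      also have "\<dots> = 2 * C * (norm a)\<^sup>2 * p b + \<delta> * D"
        by (simp add: D_def power2_eq_square algebra_simps)
      finally show "p (a \<odot> b) \<le> 2 * C * (norm a)\<^sup>2 * p b + \<epsilon>" using \<delta>(2) by linarith
    qed
  qed
qed

text \<open>If no constant worked, rescaled counterexamples would have norm 2^-n but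
  \<open>p\<close> above 1. Factoring them as \<open>c n \<odot> b\<close> with a common
  \<open>b\<close> bounds \<open>p\<close> by a multiple of the square of \<open>norm (c n)\<close>,
  which tends to 0.\<close>

lemma p_le_norm:
  assumes au: "right_bounded_units M"
  obtains K where "K \<ge> 0" "\<And>a. p a \<le> K * (norm a)\<^sup>2"
proof -
  obtain C where C: "C \<ge> 0" "\<And>a b. p (a \<odot> b) \<le> C * (norm a)\<^sup>2 * p b"
    using p_mul_le by metis
  have "\<exists>n::nat. \<forall>a. p a \<le> 4 ^ n * (norm a)\<^sup>2"
  proof (rule ccontr)
    assume "\<not> ?thesis"
    then obtain a where a: "\<And>n::nat. 4 ^ n * (norm (a n))\<^sup>2 < p (a n)"
      by (metis not_le)
    define r where "r n = 1 / (2 ^ n * norm (a n))" for n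
    have na: "norm (a n) > 0" for n
      using a[of n] by (auto simp: p_def zero_right phi.zero)
    have "norm (r n *\<^sub>R a n) = (1/2) ^ n" for n
      using na[of n] by (simp add: r_def power_one_over)
    then have "(\<lambda>n. norm (r n *\<^sub>R a n)) \<longlonglongrightarrow> 0" by (simp add: LIMSEQ_realpow_zero)
    then have "(\<lambda>n. r n *\<^sub>R a n) \<longlonglongrightarrow> 0" by (rule tendsto_norm_zero_cancel)
    then obtain b c where c: "c \<longlonglongrightarrow> 0" "\<And>n. r n *\<^sub>R a n = c n \<odot> b"
      using null_sequence_factorization[OF au] by metis
    have "(\<lambda>n. C * (norm (c n))\<^sup>2 * p b) \<longlonglongrightarrow> C * (norm (0::'a))\<^sup>2 * p b"
      by (intro tendsto_intros c)
    then have "(\<lambda>n. C * (norm (c n))\<^sup>2 * p b) \<longlonglongrightarrow> 0" by simp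
    then have "\<forall>\<^sub>F n in sequentially. C * (norm (c n))\<^sup>2 * p b < 1"
      by (rule order_tendstoD) simp
    then obtain n where "C * (norm (c n))\<^sup>2 * p b < 1" by (auto simp: eventually_sequentially)
    then have "p (r n *\<^sub>R a n) < 1" using C(2)[of "c n" b] c(2)[of n] by simp
    moreover have "p (r n *\<^sub>R a n) = p (a n) / (4 ^ n * (norm (a n))\<^sup>2)"
      unfolding p_scaleR by (simp add: r_def power_divide power_mult_distrib power_mult[symmetric] mult.commute[of n] power_mult)
    ultimately show False using a[of n] na[of n] by (simp add: divide_less_eq)
  qed
  then obtain n :: nat where "\<And>a. p a \<le> 4 ^ n * (norm a)\<^sup>2" by blast
  then show thesis by (intro that[of "4 ^ n"]) auto
qed

text \<open>Every element is a product \<open>star (star c) \<odot> b\<close>, so the symmetry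
  obtained by polarization covers the whole algebra.\<close>

lemma phi_star:
  assumes au: "right_bounded_units M"
  shows "\<phi> (star x) = cnj (\<phi> x)"
proof -
  obtain b c where x: "x = c \<odot> b" using factorization[OF au] by metis
  show ?thesis using phi_star_mul_commute[of b "star c"] by (simp add: x star_mul)
qed

text \<open>The units stay bounded for \<open>p\<close>, so they act as an approximate cyclic vector.\<close>

lemma finite_variation:
  assumes au: "right_bounded_units M"
  obtains \<gamma> where "\<gamma> \<ge> 0" "\<And>x. (cmod (\<phi> x))\<^sup>2 \<le> \<gamma> * p x"
proof -
  have M: "M \<ge> 0" by (rule right_bounded_units_nonneg[OF au])
  obtain K where K: "K \<ge> 0" "\<And>a. p a \<le> K * (norm a)\<^sup>2"
    using p_le_norm[OF au] by metis
  show thesis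
  proof (rule that)
    show "0 \<le> K * M\<^sup>2" using K by simp
    fix x
    obtain c d where x: "x = c \<odot> d" using factorization[OF au] by metis
    have "cmod (\<phi> x) \<le> sqrt (K * M\<^sup>2 * p x)"
    proof (rule field_le_epsilon)
      fix \<epsilon> :: real assume \<epsilon>: "\<epsilon> > 0"
      define D where "D = sqrt (K * p d)"
      have D: "D \<ge> 0" using K p_nonneg by (simp add: D_def)
      define \<delta> where "\<delta> = \<epsilon> / (D + 1)"
      have \<delta>: "\<delta> > 0" "\<delta> * D \<le> \<epsilon>" using \<epsilon> D by (simp_all add: \<delta>_def field_simps)
      obtain e where e: "norm e \<le> M" "norm (star c \<odot> e - star c) < \<delta>"
        using right_bounded_unitsD[OF au _ \<delta>(1), of "{star c}"] by auto
      \<comment> \<open>Here \<open>star z\<close> is \<open>c - star e \<odot> c\<close>, the error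
        of \<open>star e\<close> as a left unit. Only \<open>z\<close> is known to be small, and
        Cauchy-Schwarz for \<open>star z \<odot> d\<close> asks exactly for
        \<open>p z\<close>.\<close>
      define z where "z = star c - star c \<odot> e"
      have "\<phi> x = \<phi> (star e \<odot> x) + \<phi> (star z \<odot> d)"
        by (simp add: z_def x star.diff star_mul mul_simps phi.diff)
      then have "cmod (\<phi> x) \<le> cmod (\<phi> (star e \<odot> x)) + cmod (\<phi> (star z \<odot> d))"
        by (metis norm_triangle_ineq)
      also have "cmod (\<phi> (star e \<odot> x)) \<le> sqrt (K * M\<^sup>2 * p x)"
      proof (rule real_le_rsqrt)
        have "(cmod (\<phi> (star e \<odot> x)))\<^sup>2 \<le> p e * p x" by (rule cauchy_schwarz)
        also have "p e \<le> K * M\<^sup>2"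
          using K e(1) by (meson K(2) mult_left_mono norm_ge_zero order_trans power_mono)
        finally show "(cmod (\<phi> (star e \<odot> x)))\<^sup>2 \<le> K * M\<^sup>2 * p x"
          using p_nonneg by (meson mult_right_mono order_trans)
      qed
      also have "cmod (\<phi> (star z \<odot> d)) \<le> \<delta> * D"
      proof (rule power2_le_imp_le)
        have "(cmod (\<phi> (star z \<odot> d)))\<^sup>2 \<le> p z * p d" by (rule cauchy_schwarz)
        also have "\<dots> \<le> K * \<delta>\<^sup>2 * p d"
        proof (intro mult_right_mono p_nonneg order_trans[OF K(2)] mult_left_mono power_mono K)
          show "norm z \<le> \<delta>" using e(2) by (simp add: z_def norm_minus_commute)
        qed simp
        also have "\<dots> = (\<delta> * D)\<^sup>2" using K p_nonneg by (simp add: D_def power_mult_distrib)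
        finally show "(cmod (\<phi> (star z \<odot> d)))\<^sup>2 \<le> (\<delta> * D)\<^sup>2" .
      qed (use \<delta> D in simp)
      finally show "cmod (\<phi> x) \<le> sqrt (K * M\<^sup>2 * p x) + \<epsilon>" using \<delta>(2) by simp
    qed
    then have "(cmod (\<phi> x))\<^sup>2 \<le> (sqrt (K * M\<^sup>2 * p x))\<^sup>2" by (intro power_mono) auto
    then show "(cmod (\<phi> x))\<^sup>2 \<le> K * M\<^sup>2 * p x" using K p_nonneg by simp
  qed
qed

lemma phi_continuous:
  assumes au: "right_bounded_units M"
  shows "continuous_on UNIV \<phi>"
proof -
  obtain \<gamma> where \<gamma>: "\<gamma> \<ge> 0" "\<And>x. (cmod (\<phi> x))\<^sup>2 \<le> \<gamma> * p x"
    using finite_variation[OF au] by metis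
  obtain K where K: "K \<ge> 0" "\<And>a. p a \<le> K * (norm a)\<^sup>2"
    using p_le_norm[OF au] by metis
  have "cmod (\<phi> x) \<le> norm x * sqrt (\<gamma> * K)" for x
  proof (rule power2_le_imp_le)
    have "(cmod (\<phi> x))\<^sup>2 \<le> \<gamma> * (K * (norm x)\<^sup>2)"
      using \<gamma> K by (meson mult_left_mono order_trans)
    then show "(cmod (\<phi> x))\<^sup>2 \<le> (norm x * sqrt (\<gamma> * K))\<^sup>2"
      using \<gamma> K by (simp add: power_mult_distrib mult_ac)
  qed (use \<gamma> K in simp)
  then have "bounded_linear \<phi>"
    by (intro bounded_linear_intro[where K="sqrt (\<gamma> * K)"] phi.add phi.scaleR)
  then show ?thesis by (rule linear_continuous_on)
qed

end

section \<open>From nets to the theorem, on either side\<close>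

lemma net_converges_finite:
  assumes dir: "directed_set I le" and conv: "\<And>a. net_converges I le (f a) a"
    and F: "finite F" and \<epsilon>: "\<epsilon> > 0"
  shows "\<exists>i\<in>I. \<forall>a\<in>F. dist (f a i) a < \<epsilon>"
proof -
  have "\<exists>i0\<in>I. \<forall>i\<in>I. le i0 i \<longrightarrow> (\<forall>a\<in>F. dist (f a i) a < \<epsilon>)"
    using F
  proof (induction F rule: finite_induct)
    case empty
    from dir obtain i where "i \<in> I" unfolding directed_set_def by blast
    then show ?case by blast
  next
    case (insert a F)
    then obtain j where j: "j \<in> I" "\<And>i. i \<in> I \<Longrightarrow> le j i \<Longrightarrow> \<forall>a\<in>F. dist (f a i) a < \<epsilon>" by blast
    obtain k where k: "k \<in> I" "\<And>i. i \<in> I \<Longrightarrow> le k i \<Longrightarrow> dist (f a i) a < \<epsilon>"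
      using conv[of a] \<epsilon> unfolding net_converges_def by blast
    obtain l where l: "l \<in> I" "le j l" "le k l"
      using dir j(1) k(1) unfolding directed_set_def by blast
    have "le j i \<and> le k i" if "i \<in> I" "le l i" for i
      using dir that l j(1) k(1) unfolding directed_set_def by blast
    with j(2) k(2) l(1) show ?case by (intro bexI[of _ l]) auto
  qed
  then obtain i where "i \<in> I" "\<And>j. j \<in> I \<Longrightarrow> le i j \<Longrightarrow> \<forall>a\<in>F. dist (f a j) a < \<epsilon>" by blast
  moreover have "le i i" using dir \<open>i \<in> I\<close> unfolding directed_set_def by blast
  ultimately show ?thesis by blast
qed

theorem theorem26p6:
  fixes cscale :: "complex \<Rightarrow> 'a::{real_normed_algebra, banach} \<Rightarrow> 'a"
    and invol :: "'a \<Rightarrow> 'a"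
    and I :: "'i set" and le :: "'i \<Rightarrow> 'i \<Rightarrow> bool" and e :: "'i \<Rightarrow> 'a"
    and \<phi> :: "'a \<Rightarrow> complex"
  assumes "banach_star_algebra cscale invol"
    and "bounded_left_approx_unit I le e \<or> bounded_right_approx_unit I le e"
    and "complex_linear_functional cscale \<phi>"
    and "positive_functional invol \<phi>"
  shows "(\<exists>\<gamma>\<ge>0. \<forall>a. (cmod (\<phi> a))\<^sup>2 \<le> \<gamma> * Re (\<phi> (invol a * a)))
         \<and> continuous_on UNIV \<phi>"
proof -
  interpret A: banach_star_algebra cscale invol by fact
  have phi: "\<phi> (x + y) = \<phi> x + \<phi> y" "\<phi> (cscale c x) = c * \<phi> x" for x y c
    using assms(3) by (auto simp: complex_linear_functional_def)
  have pos: "\<phi> (invol a * a) \<in> \<real>" "0 \<le> Re (\<phi> (invol a * a))" for a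
    using assms(4) by (auto simp: positive_functional_def)
  show ?thesis using assms(2)
  proof
    assume au: "bounded_right_approx_unit I le e"
    interpret R: positive_functional_on_star "(*)" cscale invol \<phi>
      by unfold_locales (auto simp: algebra_simps norm_mult_ineq A.cscale_of_real A.cscale_add_left
          A.cscale_add_right A.cscale_assoc A.norm_cscale A.cscale_mult_left[symmetric]
          A.cscale_mult_right[symmetric] A.invol_add A.invol_cscale A.invol_mult A.invol_invol phi pos
          intro!: exI[of _ 1])
    obtain M where M: "\<And>i. i \<in> I \<Longrightarrow> norm (e i) \<le> M"
      using au by (auto simp: bounded_right_approx_unit_def)
    have "R.right_bounded_units M"
      unfolding R.right_bounded_units_def
    proof (intro allI impI)
      fix F :: "'a set" and \<epsilon> :: real assume "finite F" "\<epsilon> > 0"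
      then show "\<exists>u. norm u \<le> M \<and> (\<forall>a\<in>F. norm (a * u - a) < \<epsilon>)"
        using net_converges_finite[of I le "\<lambda>a i. a * e i" F \<epsilon>] au M
        by (auto simp: bounded_right_approx_unit_def dist_norm)
    qed
    then show ?thesis
      using R.finite_variation R.phi_continuous by (metis R.p_def)
  next
    assume au: "bounded_left_approx_unit I le e"
    text \<open>In the opposite algebra \<open>e\<close> is a right approximate unit, and \<open>\<phi>\<close> is again positive.\<close>
    have norm_le: "norm (y * x) \<le> norm x * norm y" for x y :: 'a
      using norm_mult_ineq[of y x] by (simp add: mult.commute)
    \<comment> \<open>Positivity here concerns \<open>x * invol x\<close>, which is the original
      square of \<open>invol x\<close>.\<close>
    interpret L: positive_functional_on_star "\<lambda>x y. y * x" cscale invol \<phi>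
      using pos[of "invol _"]
      by unfold_locales (auto simp: algebra_simps A.cscale_of_real A.cscale_add_left
          A.cscale_add_right A.cscale_assoc A.norm_cscale A.cscale_mult_left[symmetric]
          A.cscale_mult_right[symmetric] A.invol_add A.invol_cscale A.invol_mult A.invol_invol phi
          intro!: exI[of _ 1] norm_le norm_mult_ineq)
    obtain M where M: "\<And>i. i \<in> I \<Longrightarrow> norm (e i) \<le> M"
      using au by (auto simp: bounded_left_approx_unit_def)
    have units: "L.right_bounded_units M"
      unfolding L.right_bounded_units_def
    proof (intro allI impI)
      fix F :: "'a set" and \<epsilon> :: real assume "finite F" "\<epsilon> > 0"
      then show "\<exists>u. norm u \<le> M \<and> (\<forall>a\<in>F. norm (u * a - a) < \<epsilon>)"
        using net_converges_finite[of I le "\<lambda>a i. e i * a" F \<epsilon>] au M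
        by (auto simp: bounded_left_approx_unit_def dist_norm)
    qed
    obtain \<gamma> where \<gamma>: "\<gamma> \<ge> 0" "\<And>x. (cmod (\<phi> x))\<^sup>2 \<le> \<gamma> * Re (\<phi> (x * invol x))"
      using L.finite_variation[OF units] by (metis L.p_def)
    \<comment> \<open>The opposite product puts the factors in the wrong order; substituting
      \<open>invol a\<close> restores it, and \<phi> being hermitian leaves the modulus
      unchanged.\<close>
    have "(cmod (\<phi> a))\<^sup>2 \<le> \<gamma> * Re (\<phi> (invol a * a))" for a
      using \<gamma>(2)[of "invol a"] by (simp add: L.phi_star[OF units] A.invol_invol)
    with \<gamma>(1) L.phi_continuous[OF units] show ?thesis by blast
  qed
qed

end
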